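(* Let $X$ and $Y$ be independent real-valued Lévy processes with $m_X=\mathbb{E}X_1>0$ and $m_Y=\mathbb{E}Y_1<\infty$, and let $\omega_X^2=\mathrm{Var}(X_1)$, $\omega_Y^2=\mathrm{Var}(Y_1)$ be finite. Let $Z_t=X_t-Y_t$, $V_t=X_t-\inf_{0\le s\le t}(X_s-Y_s)$ and $\tau(u)=\inf\{t\ge0:V_t>u\}$. Let $g$ be a general (arbitrary) real-valued function of $u>0$. (i) If $\mathbb{E}Z_1>0$ then, as $u\to\infty$, $$\mathbb{P}(\tau(u)\le g(u))=\mathbb{P}\left(\frac{\tau(u)-\frac{u}{m_X}}{\sqrt{u\,\omega_X^2/m_X^3}}\le\frac{g(u)-\frac{u}{m_X}}{\sqrt{u\,\omega_X^2/m_X^3}}\right)\sim\mathbb{P}\left(N(0,1)\le\frac{g(u)-\frac{u}{m_X}}{\sqrt{u\,\omega_X^2/m_X^3}}\right).$$ (ii) If $\mathbb{E}Z_1<0$ then, as $u\to\infty$, $$\mathbb{P}(\tau(u)\le g(u))=\mathbb{P}\left(\frac{\tau(u)-\frac{u}{m_Y}}{\sqrt{u\,\omega_Y^2/m_Y^3}}\le\frac{g(u)-\frac{u}{m_Y}}{\sqrt{u\,\omega_Y^2/m_Y^3}}\right)\sim\mathbb{P}\left(N(0,1)\le\frac{g(u)-\frac{u}{m_Y}}{\sqrt{u\,\omega_Y^2/m_Y^3}}\right).$$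
   Context: $N(0,1)$ denotes a standard Gaussian random variable. For functions $p,q$, $p(u)\sim q(u)$ as $u\to\infty$ means $\lim_{u\to\infty}p(u)/q(u)=1$. Lévy processes start at $0$.
   Formalization: The relation ~ fails for arbitrary g (e.g. g = -1 gives 0 on the left); it is proved when the normalised level is eventually bounded below, while for every g the difference of the two probabilities tends to 0. The variance of X_1 in (i), of Y_1 in (ii), is taken positive. *)

theory Defs
  imports "HOL-Probability.Probability" "HOL-Library.Landau_Symbols"
begin

text \<open>
  Processes have the index set \<open>[0, \<infinity>)\<close>: in \<open>X :: real \<Rightarrow> 'a \<Rightarrow> real\<close> only the values at
  nonnegative times matter.
\<close>

definition cadlag :: "(real \<Rightarrow> real) \<Rightarrow> bool" where
  "cadlag f \<longleftrightarrow>
     (\<forall>t\<ge>0. (f \<longlongrightarrow> f t) (at_right t)) \<and>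
     (\<forall>t>0. \<exists>l. (f \<longlongrightarrow> l) (at_left t))"

text \<open>
  The paths are cadlag at every sample point, not just almost surely, so that first passage
  events are measurable without completing the probability space.  Stochastic continuity
  follows from right-continuity and stationarity and is therefore not listed.
\<close>

definition levy_process :: "'a measure \<Rightarrow> (real \<Rightarrow> 'a \<Rightarrow> real) \<Rightarrow> bool" where
  "levy_process M X \<longleftrightarrow>
     prob_space M \<and>
     (\<forall>t\<ge>0. X t \<in> borel_measurable M) \<and>
     (AE \<omega> in M. X 0 \<omega> = 0) \<and>
     (\<forall>(n::nat) (t :: nat \<Rightarrow> real). 0 \<le> t 0 \<longrightarrow> (\<forall>i<n. t i \<le> t (Suc i)) \<longrightarrow>
        prob_space.indep_vars M (\<lambda>_. borel) (\<lambda>i \<omega>. X (t (Suc i)) \<omega> - X (t i) \<omega>) {..<n}) \<and>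
     (\<forall>s\<ge>0. \<forall>h\<ge>0. distr M borel (\<lambda>\<omega>. X (s + h) \<omega> - X s \<omega>) = distr M borel (X h)) \<and>
     (\<forall>\<omega>\<in>space M. cadlag (\<lambda>t. X t \<omega>))"

text \<open>
  Independence of the two processes as wholes: each is regarded as one random element of
  the product space over all times in \<open>[0, \<infinity>)\<close>.
\<close>

definition indep_processes ::
    "'a measure \<Rightarrow> (real \<Rightarrow> 'a \<Rightarrow> real) \<Rightarrow> (real \<Rightarrow> 'a \<Rightarrow> real) \<Rightarrow> bool" where
  "indep_processes M X Y \<longleftrightarrow>
     prob_space.indep_var M
       (PiM {0..} (\<lambda>_. borel)) (\<lambda>\<omega>. \<lambda>t\<in>{0..}. X t \<omega>)
       (PiM {0..} (\<lambda>_. borel)) (\<lambda>\<omega>. \<lambda>t\<in>{0..}. Y t \<omega>)"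

definition Z_proc :: "(real \<Rightarrow> 'a \<Rightarrow> real) \<Rightarrow> (real \<Rightarrow> 'a \<Rightarrow> real) \<Rightarrow> real \<Rightarrow> 'a \<Rightarrow> real" where
  "Z_proc X Y t \<omega> = X t \<omega> - Y t \<omega>"

text \<open>
  The infimum is the conditional one of the reals; cadlag paths are bounded on \<open>[0, t]\<close>.
\<close>

definition V_proc :: "(real \<Rightarrow> 'a \<Rightarrow> real) \<Rightarrow> (real \<Rightarrow> 'a \<Rightarrow> real) \<Rightarrow> real \<Rightarrow> 'a \<Rightarrow> real" where
  "V_proc X Y t \<omega> = X t \<omega> - (INF s\<in>{0..t}. X s \<omega> - Y s \<omega>)"

text \<open>
  The passage time is extended-real valued; it is \<open>\<infinity>\<close> if the level is never exceeded.
\<close>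

definition passage_time ::
    "(real \<Rightarrow> 'a \<Rightarrow> real) \<Rightarrow> (real \<Rightarrow> 'a \<Rightarrow> real) \<Rightarrow> real \<Rightarrow> 'a \<Rightarrow> ereal" where
  "passage_time X Y u \<omega> = (INF t\<in>{t. 0 \<le> t \<and> V_proc X Y t \<omega> > u}. ereal t)"

end

theory Submission
  imports Defs "HOL-Real_Asymp.Real_Asymp"
begin

text \<open>
  Put \<open>A = X\<close> if \<open>Z\<close> has positive drift and \<open>A = Y\<close> otherwise.  By right-continuity \<open>\<tau>(u) < n\<close> means that
  \<open>X s - X r + Y r > u\<close> for some dyadic \<open>r \<le> s < n\<close>.  The supremum of the left side over such \<open>r, s\<close>
  differs from \<open>A n\<close> by \<open>o(sqrt n)\<close> in probability: the difference is a sum of processes whose drift has the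
  favourable sign, and Kolmogorov's maximal inequality, applied separately to short and long lags, controls
  their fluctuations.  The central limit theorem for \<open>A n\<close> along the integers then gives the limit of
  \<open>P(\<tau>(u) \<le> u/m + x sqrt(u v/m^3))\<close> for fixed \<open>x\<close>; since these are monotone in \<open>x\<close> and the normal
  distribution function is continuous, the convergence is uniform in \<open>x\<close>, which allows an arbitrary \<open>g\<close>.
\<close>

subsection \<open>Maximal inequalities\<close>

text \<open>A ratio limit valid for every \<open>g\<close> is impossible: where
  \<open>g u < 0\<close> the event \<open>\<tau>(u) \<le> g u\<close> is empty, while the normal
  distribution function is positive. Hence the asymptotic equivalence is claimed when the normalised
  argument is eventually bounded below, and for arbitrary \<open>g\<close> the difference tends to
  0. One inequality is easy, since a single pair of times suffices: \<open>r = 0\<close>,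
  \<open>s = n\<close> if \<open>A = X\<close>, and \<open>r = s = n\<close> if
  \<open>A = Y\<close>. The obstacle is the other one, where a supremum over all
  \<open>r \<le> s\<close> has to be replaced by the single value \<open>A n\<close>. Kolmogorov's
  inequality on all of \<open>[0, n]\<close> at level \<open>\<epsilon> * sqrt n\<close> only gives
  \<open>v / \<epsilon>\<^sup>2\<close>, which does not vanish. The drift helps: at lag
  \<open>q\<close> it tolerates a deviation of \<open>\<epsilon> * sqrt n + \<eta> * q\<close>. Lags
  up to \<open>h\<close> carry total variance \<open>h * v\<close>, negligible against
  \<open>n\<close> if \<open>h = o(n)\<close>; beyond \<open>h\<close> the tolerance is at least
  \<open>\<eta> * h\<close>, which dominates \<open>sqrt n\<close> if \<open>h\<close> does. The
  exponent 3/4 is a choice between 1/2 and 1.\<close>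

lemma (in prob_space) indep_vars_reindex:
  assumes "indep_vars (\<lambda>_. N) X I" "inj_on f L" "f ` L \<subseteq> I"
  shows "indep_vars (\<lambda>_. N) (\<lambda>j. X (f j)) L"
proof -
  \<comment> \<open>Grouping into the blocks \<open>{f j}\<close>, disjoint because \<open>f\<close>
    is injective, and projecting each block to its only entry amounts to renaming the
    indices.\<close>
  have "indep_vars (\<lambda>j. PiM {f j} (\<lambda>_. N)) (\<lambda>j \<omega>. restrict (\<lambda>i. X i \<omega>) {f j}) L"
    using assms by (intro indep_vars_restrict[OF assms(1)])
      (auto simp: disjoint_family_on_def inj_on_def)
  then have "indep_vars (\<lambda>_. N) (\<lambda>j \<omega>. (restrict (\<lambda>i. X i \<omega>) {f j}) (f j)) L"
    by (rule indep_vars_compose2) (rule measurable_component_singleton, simp)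
  then show ?thesis by simp
qed

text \<open>
  Starting the walk at an arbitrary \<open>x\<close> makes the bound an induction on the number of steps:
  conditioning on the outermost increment only moves \<open>x\<close>, so no stopping time is needed.
\<close>

lemma product_kolmogorov_maximal:
  fixes \<mu> :: "nat \<Rightarrow> real measure"
  assumes P: "\<And>i. prob_space (\<mu> i)" and S[measurable_cong]: "\<And>i. sets (\<mu> i) = sets borel"
    and I: "\<And>i. i < n \<Longrightarrow> integrable (\<mu> i) (\<lambda>x. x\<^sup>2)"
    and E: "\<And>i. i < n \<Longrightarrow> (\<integral>x. x \<partial>\<mu> i) = 0"
    and V: "\<And>i. i < n \<Longrightarrow> (\<integral>x. x\<^sup>2 \<partial>\<mu> i) = w"
    and a: "a > 0"
  shows "emeasure (PiM {..<n} \<mu>)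
      {f \<in> space (PiM {..<n} \<mu>). \<exists>k\<in>{..n}. a \<le> \<bar>x + (\<Sum>i\<in>{k..<n}. f i)\<bar>}
    \<le> ennreal ((x\<^sup>2 + n * w) / a\<^sup>2)"
  using I E V
proof (induction n arbitrary: x)
  case 0
  interpret prob_space "PiM {..<0::nat} \<mu>" by (intro prob_space_PiM P)
  show ?case
  proof (cases "a \<le> \<bar>x\<bar>")
    case True
    then have "a\<^sup>2 \<le> x\<^sup>2" using a by (metis power2_abs power_mono less_imp_le)
    then have "1 \<le> (x\<^sup>2 + 0 * w) / a\<^sup>2" using a by simp
    then have "1 \<le> ennreal ((x\<^sup>2 + real 0 * w) / a\<^sup>2)" by (metis ennreal_1 ennreal_leI of_nat_0)
    then show ?thesis by (rule order_trans[OF emeasure_le_1])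
  next
    case False
    then show ?thesis by simp
  qed
next
  case (Suc n)
  interpret mu: prob_space "\<mu> i" for i by (rule P)
  interpret product_sigma_finite \<mu> ..
  interpret Q: prob_space "PiM {..<Suc n} \<mu>" by (intro prob_space_PiM P)
  define B where "B k x = {f \<in> space (PiM {..<k} \<mu>). \<exists>j\<in>{..k}. a \<le> \<bar>x + (\<Sum>i\<in>{j..<k}. f i)\<bar>}" for k x
  have B[measurable]: "B k x \<in> sets (PiM {..<k} \<mu>)" for k x
  proof -
    have "(\<lambda>f. \<Sum>i\<in>{j..<k}. f i) \<in> borel_measurable (PiM {..<k} \<mu>)" for j
      using measurable_component_singleton[of _ "{..<k}" \<mu>]
      by (intro borel_measurable_sum) (auto simp: S cong: measurable_cong_sets)
    then show ?thesis unfolding B_def by (intro borel_measurable_le sets.sets_Collect_finite_Ex) auto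
  qed
  have w: "w \<ge> 0" using Suc.prems(3)[of n] Bochner_Integration.integral_nonneg[of "\<mu> n" "\<lambda>x. x\<^sup>2"] by simp
  show ?case
  \<comment> \<open>If the start already crosses, the claimed bound is at least 1. Otherwise the
    empty sum \<open>j = Suc n\<close> does not cross, so every crossing sum contains coordinate
    \<open>n\<close>, and fixing that coordinate only shifts \<open>x\<close>.\<close>
  proof (cases "a \<le> \<bar>x\<bar>")
    case True
    then have "a\<^sup>2 \<le> x\<^sup>2 + Suc n * w" using a w
      by (metis add_increasing2 mult_nonneg_nonneg of_nat_0_le_iff power2_abs power_mono less_imp_le)
    then have "1 \<le> (x\<^sup>2 + Suc n * w) / a\<^sup>2" using a by simp
    then have "1 \<le> ennreal ((x\<^sup>2 + Suc n * w) / a\<^sup>2)" by (metis ennreal_1 ennreal_leI)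
    then show ?thesis by (rule order_trans[OF Q.emeasure_le_1])
  next
    case False
    have ins: "{..<Suc n} = insert n {..<n}" by auto
    have "emeasure (PiM {..<Suc n} \<mu>) (B (Suc n) x)
        = (\<integral>\<^sup>+f. indicator (B (Suc n) x) f \<partial>PiM (insert n {..<n}) \<mu>)"
      using B[of "Suc n"] by (subst nn_integral_indicator) (auto simp: ins)
    also have "\<dots> = (\<integral>\<^sup>+y. (\<integral>\<^sup>+f. indicator (B (Suc n) x) (f(n := y)) \<partial>PiM {..<n} \<mu>) \<partial>\<mu> n)"
      using B[of "Suc n"] by (intro product_nn_integral_insert_rev) (auto simp: ins)
    also have "\<dots> \<le> (\<integral>\<^sup>+y. (\<integral>\<^sup>+f. indicator (B n (x + y)) f \<partial>PiM {..<n} \<mu>) \<partial>\<mu> n)"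
    proof (intro nn_integral_mono)
      fix y f assume f: "f \<in> space (PiM {..<n} \<mu>)"
      have "f \<in> B n (x + y)" if "f(n := y) \<in> B (Suc n) x"
      proof -
        from that obtain j where j: "j \<le> Suc n" "a \<le> \<bar>x + (\<Sum>i\<in>{j..<Suc n}. (f(n := y)) i)\<bar>"
          unfolding B_def by blast
        with False have "j \<le> n" by (cases "j = Suc n") auto
        then have "(\<Sum>i\<in>{j..<Suc n}. (f(n := y)) i) = (\<Sum>i\<in>{j..<n}. f i) + y"
          by simp
        with j \<open>j \<le> n\<close> f show ?thesis by (auto simp: B_def add_ac intro!: bexI[of _ j])
      qed
      then show "indicator (B (Suc n) x) (f(n := y)) \<le> (indicator (B n (x + y)) f :: ennreal)"
        by (auto simp: indicator_def)
    qed
    also have "\<dots> = (\<integral>\<^sup>+y. emeasure (PiM {..<n} \<mu>) (B n (x + y)) \<partial>\<mu> n)"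
      by simp
    also have "\<dots> \<le> (\<integral>\<^sup>+y. ennreal (((x + y)\<^sup>2 + n * w) / a\<^sup>2) \<partial>\<mu> n)"
      unfolding B_def using Suc.prems by (intro nn_integral_mono Suc.IH) auto
    also have "\<dots> = ennreal (\<integral>y. ((x + y)\<^sup>2 + n * w) / a\<^sup>2 \<partial>\<mu> n)"
    proof (intro nn_integral_eq_integral)
      have [simp]: "integrable (\<mu> n) (\<lambda>x. x)"
        using Suc.prems(1)[of n] by (intro mu.square_integrable_imp_integrable[of "\<lambda>x. x"]) auto
      show "integrable (\<mu> n) (\<lambda>y. ((x + y)\<^sup>2 + n * w) / a\<^sup>2)"
        using Suc.prems(1)[of n] by (auto simp: power2_sum)
    qed (use w in auto)
    \<comment> \<open>Centring kills the cross term \<open>2 * x * y\<close> and the new increment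
      adds one \<open>w\<close>, so a bound of the form \<open>x\<^sup>2 + n * w\<close> reproduces
      itself.\<close>
    also have "(\<integral>y. ((x + y)\<^sup>2 + n * w) / a\<^sup>2 \<partial>\<mu> n) = (x\<^sup>2 + Suc n * w) / a\<^sup>2"
    proof -
      have [simp]: "integrable (\<mu> n) (\<lambda>x. x)"
        using Suc.prems(1)[of n] by (intro mu.square_integrable_imp_integrable[of "\<lambda>x. x"]) auto
      have "(\<integral>y. (x + y)\<^sup>2 + n * w \<partial>\<mu> n) = x\<^sup>2 + Suc n * w"
        using Suc.prems[of n] by (simp add: power2_sum mu.prob_space algebra_simps)
      then show ?thesis by simp
    qed
    finally show ?thesis by (simp add: B_def)
  qed
qed

text \<open>By independence the joint law of the increments is the product of their laws, so the
  product-space bound applies with start 0. The sums run up to the last index because that induction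
  removes the last coordinate first.\<close>

lemma (in prob_space) kolmogorov_maximal_reverse:
  fixes D :: "nat \<Rightarrow> 'a \<Rightarrow> real"
  assumes D: "indep_vars (\<lambda>_. borel) D {..<n}"
    and I: "\<And>i. i < n \<Longrightarrow> integrable M (\<lambda>\<omega>. (D i \<omega>)\<^sup>2)"
    and E: "\<And>i. i < n \<Longrightarrow> expectation (D i) = 0"
    and V: "\<And>i. i < n \<Longrightarrow> expectation (\<lambda>\<omega>. (D i \<omega>)\<^sup>2) = w"
    and a: "a > 0"
  shows "prob {\<omega> \<in> space M. \<exists>k\<in>{..n}. a \<le> \<bar>\<Sum>i\<in>{k..<n}. D i \<omega>\<bar>} \<le> n * w / a\<^sup>2"
proof (cases "n = 0")
  case True
  then show ?thesis using a by simp
next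
  case False
  have rv[measurable]: "i < n \<Longrightarrow> D i \<in> borel_measurable M" for i
    using D by (auto simp: indep_vars_def2)
  have [simp]: "prob_space (return borel (0::real))" by (rule prob_space_return) simp
  \<comment> \<open>\<open>product_kolmogorov_maximal\<close> wants a probability measure at every
    index; from \<open>n\<close> on, the law of the constant 0 fills in.\<close>
  define \<mu> where "\<mu> i = distr M borel (if i < n then D i else (\<lambda>_. 0))" for i
  have w: "w \<ge> 0" using False V[of 0] Bochner_Integration.integral_nonneg[of M "\<lambda>\<omega>. (D 0 \<omega>)\<^sup>2"] by simp
  have eq: "distr M (PiM {..<n} (\<lambda>_. borel)) (\<lambda>x. \<lambda>i\<in>{..<n}. D i x) = PiM {..<n} \<mu>"
    using D False by (subst (asm) indep_vars_iff_distr_eq_PiM') (auto simp: \<mu>_def intro!: PiM_cong)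
  let ?S = "{f \<in> space (PiM {..<n} \<mu>). \<exists>k\<in>{..n}. a \<le> \<bar>0 + (\<Sum>i\<in>{k..<n}. f i)\<bar>}"
  have sets[measurable_cong]: "sets (\<mu> i) = sets borel" for i by (simp add: \<mu>_def)
  have "emeasure (PiM {..<n} \<mu>) ?S \<le> ennreal ((0\<^sup>2 + n * w) / a\<^sup>2)"
    using I E V a
    by (intro product_kolmogorov_maximal prob_space_distr sets)
      (auto simp: \<mu>_def integral_distr integrable_distr_eq intro!: prob_space_distr)
  moreover have "emeasure (PiM {..<n} \<mu>) ?S
      = emeasure M {\<omega> \<in> space M. \<exists>k\<in>{..n}. a \<le> \<bar>\<Sum>i\<in>{k..<n}. D i \<omega>\<bar>}"
  proof -
    have S: "?S \<in> sets (PiM {..<n} (\<lambda>_. borel))"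
    proof -
      have "(\<lambda>f. \<Sum>i\<in>{j..<n}. f i) \<in> borel_measurable (PiM {..<n} \<mu>)" for j
        using measurable_component_singleton[of _ "{..<n}" \<mu>]
        by (intro borel_measurable_sum) (auto simp: sets cong: measurable_cong_sets)
      then have "?S \<in> sets (PiM {..<n} \<mu>)"
        by (intro borel_measurable_le sets.sets_Collect_finite_Ex) auto
      then show ?thesis by (simp add: sets cong: sets_PiM_cong)
    qed
    have "emeasure (PiM {..<n} \<mu>) ?S = emeasure M ((\<lambda>x. \<lambda>i\<in>{..<n}. D i x) -` ?S \<inter> space M)"
      unfolding eq[symmetric] using S unfolding eq[symmetric]
      by (subst emeasure_distr) (auto intro!: measurable_restrict)
    also have "(\<lambda>x. \<lambda>i\<in>{..<n}. D i x) -` ?S \<inter> space M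
        = {\<omega> \<in> space M. \<exists>k\<in>{..n}. a \<le> \<bar>\<Sum>i\<in>{k..<n}. D i \<omega>\<bar>}"
      by (auto simp: space_PiM \<mu>_def)
    finally show ?thesis .
  qed
  ultimately show ?thesis using w by (simp add: emeasure_eq_measure)
qed

text \<open>Reading the increments backwards turns initial sums into final ones and preserves
  independence and moments.\<close>

lemma (in prob_space) kolmogorov_maximal:
  fixes D :: "nat \<Rightarrow> 'a \<Rightarrow> real"
  assumes D: "indep_vars (\<lambda>_. borel) D {..<n}"
    and I: "\<And>i. i < n \<Longrightarrow> integrable M (\<lambda>\<omega>. (D i \<omega>)\<^sup>2)"
    and E: "\<And>i. i < n \<Longrightarrow> expectation (D i) = 0"
    and V: "\<And>i. i < n \<Longrightarrow> expectation (\<lambda>\<omega>. (D i \<omega>)\<^sup>2) = w"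
    and a: "a > 0"
  shows "prob {\<omega> \<in> space M. \<exists>k\<in>{..n}. a \<le> \<bar>\<Sum>i\<in>{..<k}. D i \<omega>\<bar>} \<le> n * w / a\<^sup>2"
proof -
  have "prob {\<omega> \<in> space M. \<exists>k\<in>{..n}. a \<le> \<bar>\<Sum>i\<in>{k..<n}. D (n - Suc i) \<omega>\<bar>} \<le> n * w / a\<^sup>2"
    using assms by (intro kolmogorov_maximal_reverse indep_vars_reindex[OF D])
      (auto simp: inj_on_def)
  also have "{\<omega> \<in> space M. \<exists>k\<in>{..n}. a \<le> \<bar>\<Sum>i\<in>{k..<n}. D (n - Suc i) \<omega>\<bar>}
      = {\<omega> \<in> space M. \<exists>k\<in>{..n}. a \<le> \<bar>\<Sum>i\<in>{..<k}. D i \<omega>\<bar>}"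
  proof -
    have *: "(\<Sum>i\<in>{k..<n}. D (n - Suc i) \<omega>) = (\<Sum>i\<in>{..<n - k}. D i \<omega>)" for k \<omega>
      by (rule sum.reindex_bij_witness[of _ "\<lambda>i. n - Suc i" "\<lambda>i. n - Suc i"]) auto
    have "(\<exists>k\<in>{..n}. P (n - k)) \<longleftrightarrow> (\<exists>k\<in>{..n}. P k)" for P
      by (metis atMost_iff diff_diff_cancel diff_le_self)
    from this[of "\<lambda>k. a \<le> \<bar>\<Sum>i<k. D i \<omega>\<bar>" for \<omega>] show ?thesis
      unfolding * by simp
  qed
  finally show ?thesis .
qed

text \<open>By Fubini some constant \<open>b\<close> makes \<open>(A + b)\<^sup>2\<close>
  integrable, and this dominates \<open>A\<^sup>2\<close> up to constants. Second moments are
  assumed at time 1 only; this carries integrability down to shorter times.\<close>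

lemma (in prob_space) indep_square_integrable_summand:
  fixes A B :: "'a \<Rightarrow> real"
  assumes AB: "indep_var borel A borel B" and I: "integrable M (\<lambda>\<omega>. (A \<omega> + B \<omega>)\<^sup>2)"
  shows "integrable M (\<lambda>\<omega>. (A \<omega>)\<^sup>2)"
proof -
  have [measurable]: "A \<in> borel_measurable M" "B \<in> borel_measurable M"
    and eq: "distr M borel A \<Otimes>\<^sub>M distr M borel B = distr M (borel \<Otimes>\<^sub>M borel) (\<lambda>x. (A x, B x))"
    using AB unfolding indep_var_distribution_eq by auto
  interpret PA: prob_space "distr M borel A" by (rule prob_space_distr) simp
  interpret PB: prob_space "distr M borel B" by (rule prob_space_distr) simp
  interpret pair_sigma_finite "distr M borel B" "distr M borel A" ..
  interpret P2: pair_sigma_finite "distr M borel A" "distr M borel B" ..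
  have "integrable (distr M borel A \<Otimes>\<^sub>M distr M borel B) (\<lambda>(a, b). (a + b)\<^sup>2)"
    unfolding eq using I by (subst integrable_distr_eq) auto
  from AE_integrable_fst'[OF P2.integrable_product_swap[OF this]]
  have "AE b in distr M borel B. integrable (distr M borel A) (\<lambda>a. (a + b)\<^sup>2)"
    by simp
  then obtain b where "integrable (distr M borel A) (\<lambda>a. (a + b)\<^sup>2)"
    using eventually_happens'[OF PB.ae_filter_bot] by blast
  then have b: "integrable M (\<lambda>\<omega>. (A \<omega> + b)\<^sup>2)"
    by (subst (asm) integrable_distr_eq) simp_all
  show ?thesis
  proof (rule Bochner_Integration.integrable_bound)
    show "integrable M (\<lambda>\<omega>. 2 * (A \<omega> + b)\<^sup>2 + 2 * b\<^sup>2)" using b by simp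
    have "(A \<omega>)\<^sup>2 \<le> 2 * (A \<omega> + b)\<^sup>2 + 2 * b\<^sup>2" for \<omega>
    proof -
      have "2 * (A \<omega> + b)\<^sup>2 + 2 * b\<^sup>2 - (A \<omega>)\<^sup>2 = (A \<omega> + 2 * b)\<^sup>2"
        by (simp add: power2_eq_square algebra_simps)
      then show ?thesis by (smt (verit) zero_le_power2)
    qed
    then show "AE \<omega> in M. norm ((A \<omega>)\<^sup>2) \<le> norm (2 * (A \<omega> + b)\<^sup>2 + 2 * b\<^sup>2)"
      by simp
  qed simp
qed

subsection \<open>Square-integrable Levy processes\<close>

locale square_integrable_levy = prob_space M for M :: "'a measure" +
  fixes X :: "real \<Rightarrow> 'a \<Rightarrow> real" and m v :: real
  assumes levy: "levy_process M X"
    and square_integrable: "integrable M (\<lambda>\<omega>. (X 1 \<omega>)\<^sup>2)"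
    and mean: "m = expectation (X 1)"
    and var: "v = variance (X 1)"
begin

lemma measurable_process: "0 \<le> t \<Longrightarrow> X t \<in> borel_measurable M"
  using levy by (auto simp: levy_process_def)

lemma AE_start: "AE \<omega> in M. X 0 \<omega> = 0"
  using levy by (auto simp: levy_process_def)

lemma indep_increments:
  fixes t :: "nat \<Rightarrow> real"
  assumes "0 \<le> t 0" "\<And>i. t i \<le> t (Suc i)"
  shows "indep_vars (\<lambda>_. borel) (\<lambda>i \<omega>. X (t (Suc i)) \<omega> - X (t i) \<omega>) {..<n}"
  using levy assms unfolding levy_process_def by blast

lemma distr_increment:
  "0 \<le> s \<Longrightarrow> 0 \<le> h \<Longrightarrow> distr M borel (\<lambda>\<omega>. X (s + h) \<omega> - X s \<omega>) = distr M borel (X h)"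
  using levy unfolding levy_process_def by blast

lemma var_nonneg: "0 \<le> v"
  unfolding var by (rule variance_positive)

lemma increment_transfer:
  fixes f :: "real \<Rightarrow> real"
  assumes "0 \<le> s" "0 \<le> h" and [measurable]: "f \<in> borel_measurable borel"
  shows "integrable M (\<lambda>\<omega>. f (X (s + h) \<omega> - X s \<omega>)) \<longleftrightarrow> integrable M (\<lambda>\<omega>. f (X h \<omega>))"
    and "expectation (\<lambda>\<omega>. f (X (s + h) \<omega> - X s \<omega>)) = expectation (\<lambda>\<omega>. f (X h \<omega>))"
proof -
  have [measurable]: "X (s + h) \<in> borel_measurable M" "X s \<in> borel_measurable M" "X h \<in> borel_measurable M"
    using assms by (auto intro!: measurable_process)
  show "integrable M (\<lambda>\<omega>. f (X (s + h) \<omega> - X s \<omega>)) \<longleftrightarrow> integrable M (\<lambda>\<omega>. f (X h \<omega>))"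
    using integrable_distr_eq[of "\<lambda>\<omega>. X (s + h) \<omega> - X s \<omega>" M borel f]
      integrable_distr_eq[of "X h" M borel f] distr_increment[OF assms(1,2)] by simp
  show "expectation (\<lambda>\<omega>. f (X (s + h) \<omega> - X s \<omega>)) = expectation (\<lambda>\<omega>. f (X h \<omega>))"
    using integral_distr[of "\<lambda>\<omega>. X (s + h) \<omega> - X s \<omega>" M borel f]
      integral_distr[of "X h" M borel f] distr_increment[OF assms(1,2)] by simp
qed

text \<open>\<open>X (2 * h)\<close> is almost surely the sum of two independent increments
  distributed as \<open>X h\<close>. Expanding its square and factorising the mixed term gives
  equations that can be solved for the moments of \<open>X h\<close>.\<close>

lemma moments_half:
  assumes h: "0 \<le> h" and I: "integrable M (\<lambda>\<omega>. (X (2 * h) \<omega>)\<^sup>2)"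
    and E: "expectation (X (2 * h)) = m * (2 * h)"
    and V: "expectation (\<lambda>\<omega>. (X (2 * h) \<omega>)\<^sup>2) = v * (2 * h) + (m * (2 * h))\<^sup>2"
  shows "integrable M (\<lambda>\<omega>. (X h \<omega>)\<^sup>2) \<and> expectation (X h) = m * h \<and>
    expectation (\<lambda>\<omega>. (X h \<omega>)\<^sup>2) = v * h + (m * h)\<^sup>2"
proof -
  have [measurable]: "X h \<in> borel_measurable M" "X (2 * h) \<in> borel_measurable M" "X 0 \<in> borel_measurable M"
    using h by (auto intro!: measurable_process)
  \<comment> \<open>\<open>X 0\<close> vanishes only almost surely, so it is subtracted; the
    redundant \<open>0 +\<close> matches the form of \<open>increment_transfer\<close>.\<close>
  define A where "A \<omega> = X (0 + h) \<omega> - X 0 \<omega>" for \<omega>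
  define B where "B \<omega> = X (h + h) \<omega> - X h \<omega>" for \<omega>
  have [measurable]: "A \<in> borel_measurable M" "B \<in> borel_measurable M"
    unfolding A_def B_def by (auto simp flip: mult_2)
  have "indep_vars (\<lambda>_. borel) (\<lambda>i \<omega>. X (real (Suc i) * h) \<omega> - X (real i * h) \<omega>) {..<2}"
    using h by (intro indep_increments[of "\<lambda>i. i * h"]) (auto intro!: mult_right_mono)
  then have "indep_vars (\<lambda>_. borel) (\<lambda>i \<omega>. X (real (Suc i) * h) \<omega> - X (real i * h) \<omega>) (insert 0 {1})"
    by (rule indep_vars_subset) auto
  \<comment> \<open>The sum has the single index 1, so the effect is to turn
    \<open>indep_vars\<close> over two indices into \<open>indep_var\<close>.\<close>
  from indep_vars_sum[OF _ _ this]
  have AB: "indep_var borel A borel B"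
    unfolding A_def B_def by (simp add: algebra_simps)
  have sum: "AE \<omega> in M. A \<omega> + B \<omega> = X (2 * h) \<omega>"
    using AE_start by (auto simp: A_def B_def)
  have "integrable M (\<lambda>\<omega>. (A \<omega> + B \<omega>)\<^sup>2)"
    using I sum by (subst integrable_cong_AE[where g="\<lambda>\<omega>. (X (2 * h) \<omega>)\<^sup>2"]) auto
  from indep_square_integrable_summand[OF AB this]
  have A2: "integrable M (\<lambda>\<omega>. (A \<omega>)\<^sup>2)" .
  have X2: "integrable M (\<lambda>\<omega>. (X h \<omega>)\<^sup>2)"
    using A2 increment_transfer(1)[of 0 h "\<lambda>x. x\<^sup>2"] h by (simp add: A_def)
  have B2: "integrable M (\<lambda>\<omega>. (B \<omega>)\<^sup>2)"
    using X2 increment_transfer(1)[of h h "\<lambda>x. x\<^sup>2"] h by (simp add: B_def)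
  have [simp]: "integrable M A" "integrable M B"
    using A2 B2 by (auto intro: square_integrable_imp_integrable)
  have EA: "expectation A = expectation (X h)" "expectation B = expectation (X h)"
    using increment_transfer(2)[of 0 h "\<lambda>x. x"] increment_transfer(2)[of h h "\<lambda>x. x"] h
    by (auto simp: A_def[abs_def] B_def[abs_def])
  have EA2: "expectation (\<lambda>\<omega>. (A \<omega>)\<^sup>2) = expectation (\<lambda>\<omega>. (X h \<omega>)\<^sup>2)"
    "expectation (\<lambda>\<omega>. (B \<omega>)\<^sup>2) = expectation (\<lambda>\<omega>. (X h \<omega>)\<^sup>2)"
    using increment_transfer(2)[of 0 h "\<lambda>x. x\<^sup>2"] increment_transfer(2)[of h h "\<lambda>x. x\<^sup>2"] h
    by (auto simp: A_def[abs_def] B_def[abs_def])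
  have "m * (2 * h) = expectation (\<lambda>\<omega>. A \<omega> + B \<omega>)"
    unfolding E[symmetric] using sum by (intro integral_cong_AE) auto
  then have m: "expectation (X h) = m * h" by (simp add: EA)
  have "v * (2 * h) + (m * (2 * h))\<^sup>2 = expectation (\<lambda>\<omega>. (A \<omega> + B \<omega>)\<^sup>2)"
    unfolding V[symmetric] using sum by (intro integral_cong_AE) auto
  also have "\<dots> = expectation (\<lambda>\<omega>. (A \<omega>)\<^sup>2 + (B \<omega>)\<^sup>2 + 2 * (A \<omega> * B \<omega>))"
    by (simp add: power2_sum algebra_simps)
  also have "\<dots> = 2 * expectation (\<lambda>\<omega>. (X h \<omega>)\<^sup>2) + 2 * (m * h * (m * h))"
    using A2 B2 indep_var_integrable[OF AB] indep_var_lebesgue_integral[OF AB]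
    by (simp add: EA EA2 m)
  finally have "expectation (\<lambda>\<omega>. (X h \<omega>)\<^sup>2) = v * h + (m * h)\<^sup>2"
    by (simp add: power2_eq_square algebra_simps)
  with X2 m show ?thesis by simp
qed

lemma moments_dyadic:
  "integrable M (\<lambda>\<omega>. (X (1 / 2 ^ j) \<omega>)\<^sup>2) \<and> expectation (X (1 / 2 ^ j)) = m * (1 / 2 ^ j) \<and>
    expectation (\<lambda>\<omega>. (X (1 / 2 ^ j) \<omega>)\<^sup>2) = v * (1 / 2 ^ j) + (m * (1 / 2 ^ j))\<^sup>2"
proof (induction j)
  case 0
  have "integrable M (X 1)"
    using square_integrable by (rule square_integrable_imp_integrable[OF measurable_process, rotated]) auto
  from variance_eq[OF this square_integrable]
  have "v = expectation (\<lambda>\<omega>. (X 1 \<omega>)\<^sup>2) - m\<^sup>2"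
    unfolding var mean .
  then have "expectation (\<lambda>\<omega>. (X 1 \<omega>)\<^sup>2) = v + m\<^sup>2" by linarith
  then show ?case
    using square_integrable unfolding power_0 div_by_1 mult_1_right mean[symmetric] by blast
next
  case (Suc j)
  define h :: real where "h = 1 / 2 ^ Suc j"
  have h: "1 / 2 ^ j = 2 * h" "0 \<le> h" by (auto simp: h_def)
  show ?case
    using Suc.IH moments_half[OF h(2)] unfolding h_def[symmetric] h(1) by blast
qed

lemma centred_increments:
  fixes c :: real and j :: nat
  assumes c: "0 \<le> c"
  defines "D \<equiv> \<lambda>(i::nat) \<omega>. X (c + real (Suc i) / 2 ^ j) \<omega> - X (c + real i / 2 ^ j) \<omega> - m / 2 ^ j"
  shows "indep_vars (\<lambda>_. borel) D {..<n}"
    and "integrable M (\<lambda>\<omega>. (D i \<omega>)\<^sup>2)"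
    and "expectation (D i) = 0"
    and "expectation (\<lambda>\<omega>. (D i \<omega>)\<^sup>2) = v / 2 ^ j"
proof -
  have "indep_vars (\<lambda>_. borel) (\<lambda>i \<omega>. X (c + real (Suc i) / 2 ^ j) \<omega> - X (c + real i / 2 ^ j) \<omega>) {..<n}"
    using c by (intro indep_increments[of "\<lambda>i. c + real i / 2 ^ j"]) (auto intro!: divide_right_mono)
  from indep_vars_compose2[OF this, where Y = "\<lambda>_ x. x - m / 2 ^ j" and N = "\<lambda>_. borel"]
  show "indep_vars (\<lambda>_. borel) D {..<n}" unfolding D_def by measurable
  have eq: "c + real (Suc i) / 2 ^ j = (c + real i / 2 ^ j) + 1 / 2 ^ j"
    by (simp add: add_divide_distrib)
  have I2: "integrable M (\<lambda>\<omega>. (X (1 / 2 ^ j) \<omega>)\<^sup>2)" and E1: "expectation (X (1 / 2 ^ j)) = m / 2 ^ j"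
    and E2: "expectation (\<lambda>\<omega>. (X (1 / 2 ^ j) \<omega>)\<^sup>2) = v / 2 ^ j + (m / 2 ^ j)\<^sup>2"
    using moments_dyadic[of j] by auto
  have I1: "integrable M (X (1 / 2 ^ j))"
    using I2 by (rule square_integrable_imp_integrable[OF measurable_process, rotated]) auto
  show "integrable M (\<lambda>\<omega>. (D i \<omega>)\<^sup>2)"
    unfolding D_def eq using c I1 I2
    by (subst increment_transfer(1)[where f = "\<lambda>x. (x - m / 2 ^ j)\<^sup>2"]) (auto simp: power2_diff)
  show "expectation (D i) = 0"
    unfolding D_def eq using c I1 E1
    by (subst increment_transfer(2)[where f = "\<lambda>x. x - m / 2 ^ j"]) (auto simp: prob_space)
  show "expectation (\<lambda>\<omega>. (D i \<omega>)\<^sup>2) = v / 2 ^ j"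
    unfolding D_def eq using c I1 I2 E1 E2
    by (subst increment_transfer(2)[where f = "\<lambda>x. (x - m / 2 ^ j)\<^sup>2"])
      (simp_all add: power2_diff prob_space, simp add: power2_eq_square)
qed

lemma sum_centred_increments:
  fixes c :: real
  assumes "k \<le> n"
  shows "(\<Sum>i\<in>{k..<n}. X (c + real (Suc i) / 2 ^ j) \<omega> - X (c + real i / 2 ^ j) \<omega> - m / 2 ^ j)
    = X (c + real n / 2 ^ j) \<omega> - X (c + real k / 2 ^ j) \<omega> - m * (real n / 2 ^ j - real k / 2 ^ j)"
proof -
  define g where "g i = X (c + real i / 2 ^ j) \<omega> - m * (real i / 2 ^ j)" for i
  have "X (c + real (Suc i) / 2 ^ j) \<omega> - X (c + real i / 2 ^ j) \<omega> - m / 2 ^ j = g (Suc i) - g i" for i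
    unfolding g_def by (simp add: add_divide_distrib algebra_simps)
  then have "(\<Sum>i\<in>{k..<n}. X (c + real (Suc i) / 2 ^ j) \<omega> - X (c + real i / 2 ^ j) \<omega> - m / 2 ^ j)
      = g n - g k"
    using sum_Suc_diff'[OF assms, of g] by simp
  then show ?thesis by (simp add: g_def algebra_simps)
qed

text \<open>Refining the grid multiplies the number of increments by the factor by which it divides
  their variance. The bound is therefore free of \<open>j\<close> and survives the passage to all
  dyadic times. The offset \<open>c\<close> serves the block of short lags just before a given
  integer.\<close>

lemma grid_deviation_reverse:
  assumes a: "a > 0" and c: "0 \<le> c"
  shows "prob {\<omega> \<in> space M. \<exists>k\<in>{..n * 2 ^ j}.
      a \<le> \<bar>X (c + n) \<omega> - X (c + real k / 2 ^ j) \<omega> - m * (n - real k / 2 ^ j)\<bar>} \<le> n * v / a\<^sup>2"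
proof -
  let ?D = "\<lambda>(i::nat) \<omega>. X (c + real (Suc i) / 2 ^ j) \<omega> - X (c + real i / 2 ^ j) \<omega> - m / 2 ^ j"
  have "(\<Sum>i\<in>{k..<n * 2 ^ j}. ?D i \<omega>)
      = X (c + n) \<omega> - X (c + real k / 2 ^ j) \<omega> - m * (n - real k / 2 ^ j)" if "k \<in> {..n * 2 ^ j}" for k \<omega>
    using sum_centred_increments[of k "n * 2 ^ j" c j \<omega>] that by simp
  then have "{\<omega> \<in> space M. \<exists>k\<in>{..n * 2 ^ j}.
      a \<le> \<bar>X (c + n) \<omega> - X (c + real k / 2 ^ j) \<omega> - m * (n - real k / 2 ^ j)\<bar>}
      = {\<omega> \<in> space M. \<exists>k\<in>{..n * 2 ^ j}. a \<le> \<bar>\<Sum>i\<in>{k..<n * 2 ^ j}. ?D i \<omega>\<bar>}"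
    by (intro Collect_cong conj_cong bex_cong refl) (simp only:)
  moreover have "prob {\<omega> \<in> space M. \<exists>k\<in>{..n * 2 ^ j}. a \<le> \<bar>\<Sum>i\<in>{k..<n * 2 ^ j}. ?D i \<omega>\<bar>}
      \<le> real (n * 2 ^ j) * (v / 2 ^ j) / a\<^sup>2"
    by (rule kolmogorov_maximal_reverse[OF centred_increments[OF c] a])
  moreover have "real (n * 2 ^ j) * (v / 2 ^ j) / a\<^sup>2 = n * v / a\<^sup>2"
    by simp
  ultimately show ?thesis by (simp only:)
qed

lemma grid_deviation_forward:
  assumes a: "a > 0"
  shows "prob {\<omega> \<in> space M. \<exists>k\<in>{..n * 2 ^ j}. a \<le> \<bar>X (real k / 2 ^ j) \<omega> - X 0 \<omega> - m * (real k / 2 ^ j)\<bar>}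
    \<le> n * v / a\<^sup>2"
proof -
  let ?D = "\<lambda>(i::nat) \<omega>. X (0 + real (Suc i) / 2 ^ j) \<omega> - X (0 + real i / 2 ^ j) \<omega> - m / 2 ^ j"
  have "(\<Sum>i<k. ?D i \<omega>) = X (real k / 2 ^ j) \<omega> - X 0 \<omega> - m * (real k / 2 ^ j)" for k \<omega>
    using sum_centred_increments[of 0 k 0 j \<omega>] by (simp add: atLeast0LessThan)
  then have "{\<omega> \<in> space M. \<exists>k\<in>{..n * 2 ^ j}. a \<le> \<bar>X (real k / 2 ^ j) \<omega> - X 0 \<omega> - m * (real k / 2 ^ j)\<bar>}
      = {\<omega> \<in> space M. \<exists>k\<in>{..n * 2 ^ j}. a \<le> \<bar>\<Sum>i<k. ?D i \<omega>\<bar>}"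
    by (simp only:)
  moreover have "prob {\<omega> \<in> space M. \<exists>k\<in>{..n * 2 ^ j}. a \<le> \<bar>\<Sum>i<k. ?D i \<omega>\<bar>}
      \<le> real (n * 2 ^ j) * (v / 2 ^ j) / a\<^sup>2"
    by (rule kolmogorov_maximal[OF centred_increments[OF order_refl] a])
  moreover have "real (n * 2 ^ j) * (v / 2 ^ j) / a\<^sup>2 = n * v / a\<^sup>2"
    by simp
  ultimately show ?thesis by (simp only:)
qed

end

section \<open>Dyadic times\<close>

text \<open>
  Right-continuity lets dyadic times replace real ones.  The moments of \<open>X t\<close> are needed only at
  dyadic \<open>t\<close>, where they follow from those of \<open>X 1\<close> by halving.
\<close>

definition dyadics :: "real set" where
  "dyadics = range (\<lambda>(k::nat, j::nat). real k / 2 ^ j)"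

lemma dyadicsI: "real k / 2 ^ j \<in> dyadics"
  unfolding dyadics_def by (rule range_eqI[of _ _ "(k, j)"]) simp

lemma countable_dyadics: "countable dyadics"
  unfolding dyadics_def by simp

lemma dyadics_nonneg: "q \<in> dyadics \<Longrightarrow> 0 \<le> q"
  by (auto simp: dyadics_def)

text \<open>Lets a dyadic time after the integer \<open>c\<close> be measured from \<open>c\<close>,
  as needed for the short lags in \<open>deviation_reverse_tendsto\<close>.\<close>

lemma dyadics_diff_nat:
  assumes "q \<in> dyadics" "real c \<le> q"
  shows "q - real c \<in> dyadics"
proof -
  obtain k j where q: "q = real k / 2 ^ j" using assms by (auto simp: dyadics_def)
  have "real (c * 2 ^ j) \<le> real k" using assms by (simp add: q field_simps)
  then have "c * 2 ^ j \<le> k" by (simp only: of_nat_le_iff)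
  then have "q - real c = real (k - c * 2 ^ j) / 2 ^ j"
    by (simp add: q of_nat_diff field_simps)
  then show ?thesis by (simp only: dyadicsI)
qed

lemma dyadic_between:
  assumes "0 \<le> a" "a < b"
  shows "\<exists>q\<in>dyadics. a < q \<and> q < b"
proof -
  obtain j :: nat where j: "1 / (b - a) < 2 ^ j"
    using real_arch_pow[of 2 "1 / (b - a)"] by auto
  define k where "k = nat (\<lfloor>a * 2 ^ j\<rfloor> + 1)"
  have k: "real k = of_int \<lfloor>a * 2 ^ j\<rfloor> + 1"
    using assms by (simp add: k_def)
  have "a * 2 ^ j < real k" unfolding k by linarith
  moreover have "real k \<le> a * 2 ^ j + 1" unfolding k by linarith
  moreover have "a * 2 ^ j + 1 < b * 2 ^ j"
    using j assms by (simp add: field_simps)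
  ultimately have "a < real k / 2 ^ j" "real k / 2 ^ j < b"
    by (auto simp: field_simps)
  then show ?thesis using dyadicsI by blast
qed

text \<open>Since \<open>k / 2 ^ j = 2 * k / 2 ^ Suc j\<close>, the grids are nested. The events
  increase with \<open>j\<close>, and continuity from below keeps a bound that is uniform in
  \<open>j\<close>.\<close>

lemma (in prob_space) prob_dyadic_le:
  assumes P: "\<And>q. q \<in> dyadics \<Longrightarrow> {\<omega> \<in> space M. P q \<omega>} \<in> events"
    and b: "\<And>j. prob {\<omega> \<in> space M. \<exists>k\<in>{..n * 2 ^ j}. P (real k / 2 ^ j) \<omega>} \<le> b"
  shows "prob {\<omega> \<in> space M. \<exists>q\<in>dyadics. q \<le> real n \<and> P q \<omega>} \<le> b"
proof -
  define A where "A j = {\<omega> \<in> space M. \<exists>k\<in>{..n * 2 ^ j}. P (real k / 2 ^ j) \<omega>}" for j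
  have "incseq A"
  proof (rule incseq_SucI)
    show "A j \<subseteq> A (Suc j)" for j
    proof
      fix \<omega> assume "\<omega> \<in> A j"
      then obtain k where "\<omega> \<in> space M" "k \<le> n * 2 ^ j" "P (real k / 2 ^ j) \<omega>" by (auto simp: A_def)
      then show "\<omega> \<in> A (Suc j)" by (auto simp: A_def intro!: bexI[of _ "2 * k"])
    qed
  qed
  moreover have "range A \<subseteq> events"
    unfolding A_def by (auto intro!: sets.sets_Collect_finite_Ex P dyadicsI)
  ultimately have "(\<lambda>j. prob (A j)) \<longlonglongrightarrow> prob (\<Union>j. A j)"
    by (intro finite_Lim_measure_incseq) auto
  then have "prob (\<Union>j. A j) \<le> b"
    by (rule LIMSEQ_le_const2) (use b in \<open>auto simp: A_def\<close>)
  also have "(\<Union>j. A j) = {\<omega> \<in> space M. \<exists>q\<in>dyadics. q \<le> real n \<and> P q \<omega>}"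
  proof -
    have "k \<le> n * 2 ^ j \<longleftrightarrow> real k / 2 ^ j \<le> real n" for k j
    proof -
      have "k \<le> n * 2 ^ j \<longleftrightarrow> real k \<le> real (n * 2 ^ j)" by (simp only: of_nat_le_iff)
      then show ?thesis by (simp add: field_simps)
    qed
    then show ?thesis by (auto simp: A_def dyadics_def)
  qed
  finally show ?thesis .
qed

section \<open>Vanishing deviations and the central limit theorem\<close>

context square_integrable_levy
begin

lemma deviation_forward_pred:
  "q \<in> dyadics \<Longrightarrow> {\<omega> \<in> space M. a \<le> \<bar>X q \<omega> - X 0 \<omega> - m * q\<bar>} \<in> events"
proof -
  assume "q \<in> dyadics"
  then have [measurable]: "X q \<in> borel_measurable M" "X 0 \<in> borel_measurable M"
    using measurable_process dyadics_nonneg by auto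
  show ?thesis by measurable
qed

lemma deviation_reverse_pred:
  assumes "q \<in> dyadics" "0 \<le> c" "0 \<le> d"
  shows "{\<omega> \<in> space M. a \<le> \<bar>X d \<omega> - X (c + q) \<omega> - m * (b - q)\<bar>} \<in> events"
proof -
  have [measurable]: "X d \<in> borel_measurable M" "X (c + q) \<in> borel_measurable M"
    using measurable_process dyadics_nonneg assms by auto
  show ?thesis by measurable
qed

lemma deviation_forward_bound:
  assumes a: "a > 0"
  shows "prob {\<omega> \<in> space M. \<exists>q\<in>dyadics. q \<le> real n \<and> a \<le> \<bar>X q \<omega> - X 0 \<omega> - m * q\<bar>} \<le> n * v / a\<^sup>2"
  by (intro prob_dyadic_le grid_deviation_forward a deviation_forward_pred)

lemma deviation_reverse_bound:
  assumes a: "a > 0" and c: "0 \<le> c"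
  shows "prob {\<omega> \<in> space M. \<exists>q\<in>dyadics. q \<le> real n \<and>
    a \<le> \<bar>X (c + n) \<omega> - X (c + q) \<omega> - m * (n - q)\<bar>} \<le> n * v / a\<^sup>2"
  using c by (intro prob_dyadic_le grid_deviation_reverse a deviation_reverse_pred) auto

text \<open>
  The two terms are Kolmogorov bounds for lags at most and beyond \<open>h n\<close>; any \<open>h n\<close> between the
  orders \<open>sqrt n\<close> and \<open>n\<close> makes both vanish.
\<close>

lemma two_block_bound_tendsto:
  assumes "\<epsilon> > 0" "\<eta> > 0"
  defines "h \<equiv> \<lambda>n::nat. nat \<lfloor>real n powr (3/4)\<rfloor>"
  shows "(\<lambda>n. real (h n) * v / (\<epsilon> * sqrt n)\<^sup>2 + real n * v / (\<eta> * real (h n))\<^sup>2) \<longlonglongrightarrow> 0"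
proof (rule tendsto_sandwich[OF _ _ tendsto_const])
  show "\<forall>\<^sub>F n in sequentially. 0 \<le> real (h n) * v / (\<epsilon> * sqrt n)\<^sup>2 + real n * v / (\<eta> * real (h n))\<^sup>2"
    using var_nonneg
    by (intro always_eventually allI add_nonneg_nonneg divide_nonneg_nonneg mult_nonneg_nonneg) auto
  have h: "real (h n) \<le> real n powr (3/4)" "real n powr (3/4) - 1 \<le> real (h n)" for n
    unfolding h_def by (auto simp: of_nat_nat)
  \<comment> \<open>For \<open>n \<ge> 2\<close> the quantity \<open>real n powr (3/4) - 1\<close>
    is positive and may replace \<open>h n\<close> in a denominator; the new bound contains no
    floor, so its limit is a routine asymptotic computation.\<close>
  have "real (h n) * v / (\<epsilon> * sqrt n)\<^sup>2 + real n * v / (\<eta> * real (h n))\<^sup>2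
      \<le> real n powr (3/4) * v / (\<epsilon> * sqrt n)\<^sup>2 + real n * v / (\<eta> * (real n powr (3/4) - 1))\<^sup>2"
    if "n \<ge> 2" for n
  proof -
    have "real n powr (3/4) > 1" using that by (simp add: gr_one_powr)
    then show ?thesis using h[of n] var_nonneg assms(1,2)
      by (intro add_mono divide_right_mono mult_right_mono divide_left_mono power_mono mult_left_mono
            mult_pos_pos zero_less_power mult_nonneg_nonneg) auto
  qed
  moreover have "real n powr (3/4) * v / (\<epsilon> * sqrt n)\<^sup>2 + real n * v / (\<eta> * (real n powr (3/4) - 1))\<^sup>2
      = v / \<epsilon>\<^sup>2 * (real n powr (3/4) / (sqrt n)\<^sup>2) + v / \<eta>\<^sup>2 * (real n / (real n powr (3/4) - 1)\<^sup>2)" for n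
    by (simp only: power_mult_distrib times_divide_times_eq mult.commute)
  ultimately show "\<forall>\<^sub>F n in sequentially. real (h n) * v / (\<epsilon> * sqrt n)\<^sup>2 + real n * v / (\<eta> * real (h n))\<^sup>2
      \<le> v / \<epsilon>\<^sup>2 * (real n powr (3/4) / (sqrt n)\<^sup>2) + v / \<eta>\<^sup>2 * (real n / (real n powr (3/4) - 1)\<^sup>2)"
    unfolding eventually_sequentially by metis
  have "(\<lambda>n::nat. real n powr (3/4) / (sqrt n)\<^sup>2) \<longlonglongrightarrow> 0" by real_asymp
  moreover have "(\<lambda>n::nat. real n / (real n powr (3/4) - 1)\<^sup>2) \<longlonglongrightarrow> 0" by real_asymp
  ultimately have "(\<lambda>n. v / \<epsilon>\<^sup>2 * (real n powr (3/4) / (sqrt n)\<^sup>2) + v / \<eta>\<^sup>2 * (real n / (real n powr (3/4) - 1)\<^sup>2))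
      \<longlonglongrightarrow> v / \<epsilon>\<^sup>2 * 0 + v / \<eta>\<^sup>2 * 0" by (intro tendsto_intros)
  then show "(\<lambda>n. v / \<epsilon>\<^sup>2 * (real n powr (3/4) / (sqrt n)\<^sup>2) + v / \<eta>\<^sup>2 * (real n / (real n powr (3/4) - 1)\<^sup>2))
      \<longlonglongrightarrow> 0" by simp
qed

lemma deviation_forward_event:
  "{\<omega> \<in> space M. \<exists>q\<in>dyadics. q \<le> b \<and> f q \<le> \<bar>X q \<omega> - X 0 \<omega> - m * q\<bar>} \<in> events"
  by (intro sets.sets_Collect_countable_Ex' sets.sets_Collect_conj sets.sets_Collect_const
      deviation_forward_pred countable_dyadics)

lemma deviation_reverse_event:
  assumes "0 \<le> c" "0 \<le> d"
  shows "{\<omega> \<in> space M. \<exists>q\<in>dyadics. q \<le> b \<and> f q \<le> \<bar>X d \<omega> - X (c + q) \<omega> - m * (b - q)\<bar>} \<in> events"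
  by (intro sets.sets_Collect_countable_Ex' sets.sets_Collect_conj sets.sets_Collect_const
      deviation_reverse_pred countable_dyadics assms)

text \<open>Up to lag \<open>h\<close> only the constant part of the barrier is used; beyond it only
  the linear part, which there is at least \<open>\<eta> * h\<close>. Each case is one maximal
  inequality with a constant threshold.\<close>

lemma deviation_forward_tendsto:
  assumes e: "\<epsilon> > 0" "\<eta> > 0"
  shows "(\<lambda>n. prob {\<omega> \<in> space M. \<exists>q\<in>dyadics. q \<le> real n \<and>
    \<epsilon> * sqrt n + \<eta> * q \<le> \<bar>X q \<omega> - X 0 \<omega> - m * q\<bar>}) \<longlonglongrightarrow> 0"
proof (rule tendsto_sandwich[OF _ _ tendsto_const two_block_bound_tendsto[OF e]])
  let ?h = "\<lambda>n::nat. nat \<lfloor>real n powr (3/4)\<rfloor>"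
  have "prob {\<omega> \<in> space M. \<exists>q\<in>dyadics. q \<le> real n \<and> \<epsilon> * sqrt n + \<eta> * q \<le> \<bar>X q \<omega> - X 0 \<omega> - m * q\<bar>}
      \<le> real (?h n) * v / (\<epsilon> * sqrt n)\<^sup>2 + real n * v / (\<eta> * real (?h n))\<^sup>2" (is "prob ?A \<le> _") if n: "n \<ge> 1" for n
  proof -
    define h where "h = ?h n"
    have h: "h \<ge> 1" using n by (simp add: h_def le_nat_iff ge_one_powr_ge_zero)
    let ?B = "{\<omega> \<in> space M. \<exists>q\<in>dyadics. q \<le> real h \<and> \<epsilon> * sqrt n \<le> \<bar>X q \<omega> - X 0 \<omega> - m * q\<bar>}"
    let ?C = "{\<omega> \<in> space M. \<exists>q\<in>dyadics. q \<le> real n \<and> \<eta> * real h \<le> \<bar>X q \<omega> - X 0 \<omega> - m * q\<bar>}"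
    have "?A \<subseteq> ?B \<union> ?C"
    proof
      fix \<omega> assume "\<omega> \<in> ?A"
      then obtain q where q: "\<omega> \<in> space M" "q \<in> dyadics" "q \<le> real n"
        "\<epsilon> * sqrt n + \<eta> * q \<le> \<bar>X q \<omega> - X 0 \<omega> - m * q\<bar>" by auto
      have "0 \<le> \<eta> * q" "0 \<le> \<epsilon> * sqrt n" using e dyadics_nonneg[OF q(2)] by auto
      moreover have "\<eta> * real h \<le> \<eta> * q" if "real h \<le> q" using that e by simp
      ultimately show "\<omega> \<in> ?B \<union> ?C" using q by (cases "q \<le> real h") force+
    qed
    then have "prob ?A \<le> prob (?B \<union> ?C)" by (intro finite_measure_mono sets.Un deviation_forward_event)
    also have "\<dots> \<le> prob ?B + prob ?C" by (intro measure_Un_le deviation_forward_event)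
    also have "\<dots> \<le> real h * v / (\<epsilon> * sqrt n)\<^sup>2 + real n * v / (\<eta> * real h)\<^sup>2"
      using e n h by (intro add_mono deviation_forward_bound) auto
    finally show ?thesis unfolding h_def .
  qed
  then show "\<forall>\<^sub>F n in sequentially. prob {\<omega> \<in> space M. \<exists>q\<in>dyadics. q \<le> real n \<and>
      \<epsilon> * sqrt n + \<eta> * q \<le> \<bar>X q \<omega> - X 0 \<omega> - m * q\<bar>}
      \<le> real (?h n) * v / (\<epsilon> * sqrt n)\<^sup>2 + real n * v / (\<eta> * real (?h n))\<^sup>2"
    unfolding eventually_sequentially by blast
qed simp

text \<open>Lags are counted back from \<open>n\<close>, so the short ones fill the block from
  \<open>n - h\<close> to \<open>n\<close>, and the maximal inequality is applied there to the
  process restarted at \<open>c = n - h\<close>.\<close>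

lemma deviation_reverse_tendsto:
  assumes e: "\<epsilon> > 0" "\<eta> > 0"
  shows "(\<lambda>n. prob {\<omega> \<in> space M. \<exists>q\<in>dyadics. q \<le> real n \<and>
    \<epsilon> * sqrt n + \<eta> * (n - q) \<le> \<bar>X n \<omega> - X q \<omega> - m * (n - q)\<bar>}) \<longlonglongrightarrow> 0"
proof (rule tendsto_sandwich[OF _ _ tendsto_const two_block_bound_tendsto[OF e]])
  let ?h = "\<lambda>n::nat. nat \<lfloor>real n powr (3/4)\<rfloor>"
  have "prob {\<omega> \<in> space M. \<exists>q\<in>dyadics. q \<le> real n \<and>
        \<epsilon> * sqrt n + \<eta> * (n - q) \<le> \<bar>X n \<omega> - X q \<omega> - m * (n - q)\<bar>}
      \<le> real (?h n) * v / (\<epsilon> * sqrt n)\<^sup>2 + real n * v / (\<eta> * real (?h n))\<^sup>2" (is "prob ?A \<le> _") if n: "n \<ge> 1" for n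
  proof -
    define h where "h = ?h n"
    have h: "h \<ge> 1" using n by (simp add: h_def le_nat_iff ge_one_powr_ge_zero)
    have "real n powr (3/4) \<le> real n powr 1" using n by (intro powr_mono) auto
    then have hn: "h \<le> n" using n by (simp add: h_def nat_le_iff floor_le_iff)
    define c where "c = n - h"
    have c: "real n = real c + real h" using hn by (simp add: c_def of_nat_diff)
    let ?B = "{\<omega> \<in> space M. \<exists>q\<in>dyadics. q \<le> real h \<and>
      \<epsilon> * sqrt n \<le> \<bar>X (real c + h) \<omega> - X (real c + q) \<omega> - m * (real h - q)\<bar>}"
    \<comment> \<open>The summands 0 are written out so that \<open>deviation_reverse_bound\<close>
      applies with \<open>c = 0\<close>.\<close>
    let ?C = "{\<omega> \<in> space M. \<exists>q\<in>dyadics. q \<le> real n \<and>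
      \<eta> * real h \<le> \<bar>X (0 + real n) \<omega> - X (0 + q) \<omega> - m * (real n - q)\<bar>}"
    have "?A \<subseteq> ?B \<union> ?C"
    proof
      fix \<omega> assume "\<omega> \<in> ?A"
      then obtain q :: real where q: "\<omega> \<in> space M" "q \<in> dyadics" "q \<le> real n"
        "\<epsilon> * sqrt n + \<eta> * (n - q) \<le> \<bar>X n \<omega> - X q \<omega> - m * (n - q)\<bar>" by auto
      have pos: "0 \<le> \<eta> * (n - q)" "0 \<le> \<epsilon> * sqrt n" using e q(3) by auto
      show "\<omega> \<in> ?B \<union> ?C"
      proof (cases "real c \<le> q")
        case True
        have "\<epsilon> * sqrt n \<le> \<bar>X (real c + h) \<omega> - X (real c + (q - c)) \<omega> - m * (real h - (q - c))\<bar>"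
          using q(4) pos unfolding c by (simp add: algebra_simps)
        moreover have "q - c \<le> real h" using q(3) c by simp
        ultimately show ?thesis using q(1) dyadics_diff_nat[OF q(2) True] by blast
      next
        case False
        then have "\<eta> * real h \<le> \<eta> * (n - q)" using e c by simp
        with q pos show ?thesis by force
      qed
    qed
    then have "prob ?A \<le> prob (?B \<union> ?C)" by (intro finite_measure_mono sets.Un deviation_reverse_event) auto
    also have "\<dots> \<le> prob ?B + prob ?C" by (intro measure_Un_le deviation_reverse_event) auto
    also have "\<dots> \<le> real h * v / (\<epsilon> * sqrt n)\<^sup>2 + real n * v / (\<eta> * real h)\<^sup>2"
      using e n h by (intro add_mono deviation_reverse_bound) auto
    finally show ?thesis unfolding h_def .
  qed
  then show "\<forall>\<^sub>F n in sequentially. prob {\<omega> \<in> space M. \<exists>q\<in>dyadics. q \<le> real n \<and>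
      \<epsilon> * sqrt n + \<eta> * (n - q) \<le> \<bar>X n \<omega> - X q \<omega> - m * (n - q)\<bar>}
      \<le> real (?h n) * v / (\<epsilon> * sqrt n)\<^sup>2 + real n * v / (\<eta> * real (?h n))\<^sup>2"
    unfolding eventually_sequentially by blast
qed simp

lemma central_limit_integer_times:
  assumes v: "v > 0"
  shows "(\<lambda>n. prob {\<omega> \<in> space M. (X (real n) \<omega> - m * n) / sqrt (n * v) \<le> y})
    \<longlonglongrightarrow> measure std_normal_distribution {z. z \<le> y}"
proof -
  define D where "D i \<omega> = X (real (Suc i)) \<omega> - X (real i) \<omega>" for i \<omega>
  have [measurable]: "X (real i) \<in> borel_measurable M" for i by (rule measurable_process) simp
  have [measurable]: "X 0 \<in> borel_measurable M" by (rule measurable_process) simp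
  have [measurable]: "D i \<in> borel_measurable M" for i unfolding D_def by measurable
  have fin: "indep_vars (\<lambda>_. borel) D {..<n}" for n
    unfolding D_def by (rule indep_increments) auto
  \<comment> \<open>The definition of the process yields independence of initial segments of
    increments. Independence of the whole sequence only concerns finite index sets, and each lies in
    such a segment.\<close>
  have ind: "indep_vars (\<lambda>_. borel) D UNIV"
    unfolding indep_vars_def2
  proof (intro conjI ballI)
    show "indep_sets (\<lambda>i. {D i -` A \<inter> space M |A. A \<in> sets borel}) UNIV"
    proof (subst indep_sets_finite_index_sets, intro allI impI)
      fix J :: "nat set" assume "finite J"
      then have "J \<subseteq> {..<Suc (Max J)}" by (auto simp: less_Suc_eq_le)
      then show "indep_sets (\<lambda>i. {D i -` A \<inter> space M |A. A \<in> sets borel}) J"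
        using fin[of "Suc (Max J)"] unfolding indep_vars_def2 by (blast intro: indep_sets_mono_index)
    qed
  qed simp
  have Deq: "D i = (\<lambda>\<omega>. X (real i + 1) \<omega> - X (real i) \<omega>)" for i
    by (simp add: D_def add.commute fun_eq_iff)
  have ED: "expectation (D i) = m" for i
    unfolding Deq mean by (subst increment_transfer(2)[where f = "\<lambda>x. x"]) auto
  have "weak_conv_m (\<lambda>n. distr M borel (\<lambda>\<omega>. (\<Sum>i<n. D i \<omega> - m) / sqrt (n * (sqrt v)\<^sup>2))) std_normal_distribution"
  proof (rule central_limit_theorem[OF ind ED])
    show "sqrt v > 0" using v by simp
    show "integrable M (\<lambda>\<omega>. (D i \<omega>)\<^sup>2)" for i
      unfolding Deq using square_integrable
      by (subst increment_transfer(1)[where f = "\<lambda>x. x\<^sup>2"]) auto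
    show "variance (D i) = (sqrt v)\<^sup>2" for i
      unfolding ED unfolding Deq using v
      by (subst increment_transfer(2)[where f = "\<lambda>x. (x - m)\<^sup>2"]) (auto simp: var mean)
    show "distr M borel (D i) = distr M borel (X 1)" for i
      unfolding Deq by (rule distr_increment) auto
  qed
  moreover have "distr M borel (\<lambda>\<omega>. (\<Sum>i<n. D i \<omega> - m) / sqrt (n * (sqrt v)\<^sup>2))
      = distr M borel (\<lambda>\<omega>. (X (real n) \<omega> - m * n) / sqrt (n * v))" for n
  proof (rule distr_cong_AE)
    have "(\<Sum>i<n. D i \<omega> - m) = X (real n) \<omega> - X 0 \<omega> - m * n" for \<omega>
      using sum_lessThan_telescope[of "\<lambda>i. X (real i) \<omega>" n]
      by (simp add: sum_subtractf D_def)
    then show "AE \<omega> in M. (\<Sum>i<n. D i \<omega> - m) / sqrt (n * (sqrt v)\<^sup>2) = (X (real n) \<omega> - m * n) / sqrt (n * v)"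
      using AE_start v by auto
  qed auto
  ultimately have W: "weak_conv_m (\<lambda>n. distr M borel (\<lambda>\<omega>. (X (real n) \<omega> - m * n) / sqrt (n * v))) std_normal_distribution"
    by simp
  have "isCont (cdf std_normal_distribution) y"
  proof -
    interpret N: real_distribution std_normal_distribution by (rule real_dist_normal_dist)
    have "emeasure std_normal_distribution {y} = 0"
      by (simp add: emeasure_density nn_integral_null_delta)
    then show ?thesis unfolding N.isCont_cdf by (simp add: measure_def)
  qed
  with W have "(\<lambda>n. cdf (distr M borel (\<lambda>\<omega>. (X (real n) \<omega> - m * n) / sqrt (n * v))) y)
      \<longlonglongrightarrow> cdf std_normal_distribution y"
    unfolding weak_conv_m_def weak_conv_def by blast
  moreover have "cdf (distr M borel (\<lambda>\<omega>. (X (real n) \<omega> - m * n) / sqrt (n * v))) y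
      = prob {\<omega> \<in> space M. (X (real n) \<omega> - m * n) / sqrt (n * v) \<le> y}" for n
    unfolding cdf_def by (subst measure_distr) (auto intro!: arg_cong[where f = prob])
  ultimately show ?thesis by (simp add: cdf_def atMost_def)
qed

end

subsection \<open>Passage times and dyadic times\<close>

text \<open>One-sided limits bound the path near each point, and bounds on adjacent intervals
  combine, so Bolzano's interval principle covers \<open>{0..t}\<close>.\<close>

lemma cadlag_bounded:
  assumes "cadlag f"
  shows "\<exists>B. \<forall>s\<in>{0..t}. \<bar>f s\<bar> \<le> B"
proof (cases "0 \<le> t")
  case True
  \<comment> \<open>The guard \<open>0 \<le> s\<close> is there because Bolzano's principle also
    tests intervals reaching left of 0, where \<open>cadlag\<close> says nothing.\<close>
  define P where "P a b \<longleftrightarrow> (\<exists>B. \<forall>s\<in>{a..b}. 0 \<le> s \<longrightarrow> \<bar>f s\<bar> \<le> B)" for a b :: real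
  have "P 0 t"
  proof (rule Bolzano[OF True])
    fix a b c assume "P a b" "P b c"
    then obtain B C where "\<forall>s\<in>{a..b}. 0 \<le> s \<longrightarrow> \<bar>f s\<bar> \<le> B" "\<forall>s\<in>{b..c}. 0 \<le> s \<longrightarrow> \<bar>f s\<bar> \<le> C"
      by (auto simp: P_def)
    then have "\<forall>s\<in>{a..c}. 0 \<le> s \<longrightarrow> \<bar>f s\<bar> \<le> max B C"
      by (metis atLeastAtMost_iff linear max.coboundedI1 max.coboundedI2)
    then show "P a c" unfolding P_def by blast
  next
    fix x assume x: "0 \<le> x" "x \<le> t"
    have "(f \<longlongrightarrow> f x) (at_right x)" using assms x by (auto simp: cadlag_def)
    from tendstoD[OF this, of 1] obtain b where b: "b > x" "\<And>s. x < s \<Longrightarrow> s < b \<Longrightarrow> dist (f s) (f x) < 1"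
      unfolding eventually_at_right_field by auto
    have "\<exists>a<x. \<exists>C. \<forall>s. a < s \<and> s < x \<and> 0 \<le> s \<longrightarrow> \<bar>f s\<bar> \<le> C"
    proof (cases "x = 0")
      case True
      then show ?thesis by (intro exI[of _ "-1"]) auto
    next
      case False
      with x have "0 < x" by simp
      then obtain l where "(f \<longlongrightarrow> l) (at_left x)" using assms unfolding cadlag_def by blast
      from tendstoD[OF this, of 1] obtain a where a: "a < x" "\<And>s. a < s \<Longrightarrow> s < x \<Longrightarrow> dist (f s) l < 1"
        unfolding eventually_at_left_field by auto
      have "\<bar>f s\<bar> \<le> \<bar>l\<bar> + 1" if "a < s" "s < x" for s
        using a(2)[OF that] by (auto simp: dist_real_def)
      with a(1) show ?thesis by blast
    qed
    then obtain a C where a: "a < x" "\<And>s. a < s \<Longrightarrow> s < x \<Longrightarrow> 0 \<le> s \<Longrightarrow> \<bar>f s\<bar> \<le> C"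
      by blast
    have "P c d" if "c \<le> x" "x \<le> d" "d - c < min (b - x) (x - a)" for c d
    proof -
      have "\<bar>f s\<bar> \<le> max C (\<bar>f x\<bar> + 1)" if s: "s \<in> {c..d}" "0 \<le> s" for s
      proof -
        consider "s < x" | "s = x" | "x < s" by linarith
        then show ?thesis
        proof cases
          case 1
          then have "\<bar>f s\<bar> \<le> C" using s \<open>d - c < _\<close> \<open>x \<le> d\<close> by (intro a(2)) auto
          then show ?thesis by simp
        next
          case 3
          then have "dist (f s) (f x) < 1" using s \<open>d - c < _\<close> \<open>c \<le> x\<close> by (intro b(2)) auto
          then show ?thesis by (auto simp: dist_real_def)
        qed simp
      qed
      then show ?thesis unfolding P_def by blast
    qed
    then show "\<exists>d>0. \<forall>a b. a \<le> x \<and> x \<le> b \<and> b - a < d \<longrightarrow> P a b"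
      using a(1) b(1) by (intro exI[of _ "min (b - x) (x - a)"]) auto
  qed
  then show ?thesis by (auto simp: P_def)
qed auto

lemma eventually_at_right_dyadic:
  assumes "eventually P (at_right x)" "0 \<le> x" "x < b"
  shows "\<exists>q\<in>dyadics. x < q \<and> q < b \<and> P q"
proof -
  obtain c where c: "c > x" "\<And>y. x < y \<Longrightarrow> y < c \<Longrightarrow> P y"
    using assms(1) unfolding eventually_at_right_field by auto
  then obtain q where "q \<in> dyadics" "x < q" "q < min b c"
    using dyadic_between[of x "min b c"] assms by auto
  then show ?thesis using c(2)[of q] by auto
qed

text \<open>Replacing the conditional infimum by an existential requires a lower bound, which
  boundedness of cadlag paths supplies.\<close>

lemma V_proc_greater_iff:
  assumes "cadlag (\<lambda>t. X t \<omega>)" "cadlag (\<lambda>t. Y t \<omega>)" "0 \<le> s"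
  shows "u < V_proc X Y s \<omega> \<longleftrightarrow> (\<exists>r\<in>{0..s}. u < X s \<omega> - X r \<omega> + Y r \<omega>)"
proof -
  obtain B C where BC: "\<forall>r\<in>{0..s}. \<bar>X r \<omega>\<bar> \<le> B" "\<forall>r\<in>{0..s}. \<bar>Y r \<omega>\<bar> \<le> C"
    using cadlag_bounded[OF assms(1)] cadlag_bounded[OF assms(2)] by metis
  have "bdd_below ((\<lambda>r. X r \<omega> - Y r \<omega>) ` {0..s})"
    using BC by (intro bdd_belowI2[of _ "- B - C"]) fastforce
  then have "(INF r\<in>{0..s}. X r \<omega> - Y r \<omega>) < X s \<omega> - u \<longleftrightarrow> (\<exists>r\<in>{0..s}. X r \<omega> - Y r \<omega> < X s \<omega> - u)"
    using assms(3) by (intro cINF_less_iff) auto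
  moreover have "u < V_proc X Y s \<omega> \<longleftrightarrow> (INF r\<in>{0..s}. X r \<omega> - Y r \<omega>) < X s \<omega> - u"
    unfolding V_proc_def by linarith
  moreover have "X r \<omega> - Y r \<omega> < X s \<omega> - u \<longleftrightarrow> u < X s \<omega> - X r \<omega> + Y r \<omega>" for r
    by linarith
  ultimately show ?thesis by simp
qed

text \<open>Both inequalities are strict, so they survive a small move of the times to the right,
  the side on which the paths are continuous. The outcome is a countable union, which gives
  measurability and exposes the event to the bounds at dyadic times.\<close>

lemma passage_time_less_iff:
  assumes X: "cadlag (\<lambda>t. X t \<omega>)" and Y: "cadlag (\<lambda>t. Y t \<omega>)"
  shows "passage_time X Y u \<omega> < ereal t \<longleftrightarrow>
    (\<exists>r\<in>dyadics. \<exists>s\<in>dyadics. r \<le> s \<and> s < t \<and> u < X s \<omega> - X r \<omega> + Y r \<omega>)"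
proof
  assume "passage_time X Y u \<omega> < ereal t"
  then obtain s where s: "0 \<le> s" "s < t" "u < V_proc X Y s \<omega>"
    by (auto simp: passage_time_def INF_less_iff)
  then obtain r where r: "0 \<le> r" "r \<le> s" and u: "u < X s \<omega> - X r \<omega> + Y r \<omega>"
    using V_proc_greater_iff[where X = X and Y = Y and \<omega> = \<omega>, OF X Y] by auto
  have Xlim: "((\<lambda>t. X t \<omega>) \<longlongrightarrow> X z \<omega>) (at_right z)" if "0 \<le> z" for z
    using X that by (auto simp: cadlag_def)
  have Ylim: "((\<lambda>t. Y t \<omega>) \<longlongrightarrow> Y z \<omega>) (at_right z)" if "0 \<le> z" for z
    using Y that by (auto simp: cadlag_def)
  show "\<exists>r\<in>dyadics. \<exists>s\<in>dyadics. r \<le> s \<and> s < t \<and> u < X s \<omega> - X r \<omega> + Y r \<omega>"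
  proof (cases "r = s")
    case True
    \<comment> \<open>The increment of \<open>X\<close> is zero and stays zero if both times move to
      the same dyadic point, so only \<open>Y\<close> has to remain above \<open>u\<close>. Moving
      \<open>r\<close> alone would violate \<open>r \<le> s\<close>.\<close>
    then have "eventually (\<lambda>q. u < Y q \<omega>) (at_right s)"
      using u by (intro order_tendstoD(1)[OF Ylim[OF s(1)]]) simp
    from eventually_at_right_dyadic[OF this s(1,2)] show ?thesis by force
  next
    case False
    \<comment> \<open>\<open>r\<close> moves first and stays below \<open>s\<close>; moving
      \<open>s\<close> to the right afterwards cannot disturb the order.\<close>
    have "((\<lambda>q. X s \<omega> - X q \<omega> + Y q \<omega>) \<longlongrightarrow> X s \<omega> - X r \<omega> + Y r \<omega>) (at_right r)"
      by (intro tendsto_intros Xlim Ylim r)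
    from order_tendstoD(1)[OF this u] obtain r' where r': "r' \<in> dyadics" "r' < s" "u < X s \<omega> - X r' \<omega> + Y r' \<omega>"
      using eventually_at_right_dyadic[of _ r s] r False by force
    have "((\<lambda>q. X q \<omega> - X r' \<omega> + Y r' \<omega>) \<longlongrightarrow> X s \<omega> - X r' \<omega> + Y r' \<omega>) (at_right s)"
      by (intro tendsto_intros Xlim s)
    from order_tendstoD(1)[OF this r'(3)] obtain s' where "s' \<in> dyadics" "s < s'" "s' < t" "u < X s' \<omega> - X r' \<omega> + Y r' \<omega>"
      using eventually_at_right_dyadic[of _ s t] s by force
    with r' show ?thesis by (intro bexI[of _ r'] bexI[of _ s']) auto
  qed
next
  assume "\<exists>r\<in>dyadics. \<exists>s\<in>dyadics. r \<le> s \<and> s < t \<and> u < X s \<omega> - X r \<omega> + Y r \<omega>"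
  then obtain r s where rs: "r \<in> dyadics" "s \<in> dyadics" "r \<le> s" "s < t" "u < X s \<omega> - X r \<omega> + Y r \<omega>"
    by blast
  then have "u < V_proc X Y s \<omega>" "0 \<le> s"
    using V_proc_greater_iff[where X = X and Y = Y and \<omega> = \<omega>, OF X Y] dyadics_nonneg by auto
  with rs(4) show "passage_time X Y u \<omega> < ereal t"
    by (auto simp: passage_time_def INF_less_iff)
qed

lemma passage_time_le:
  assumes "cadlag (\<lambda>t. X t \<omega>)" "cadlag (\<lambda>t. Y t \<omega>)" "0 \<le> r" "r \<le> s" "u < X s \<omega> - X r \<omega> + Y r \<omega>"
  shows "passage_time X Y u \<omega> \<le> ereal s"
  unfolding passage_time_def
  using assms V_proc_greater_iff[where X = X and Y = Y and \<omega> = \<omega>, OF assms(1,2), of s u] by (intro INF_lower) auto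

context
  fixes M :: "'a measure" and X Y :: "real \<Rightarrow> 'a \<Rightarrow> real"
  assumes X: "levy_process M X" and Y: "levy_process M Y"
begin

lemma passage_time_less_event: "{\<omega> \<in> space M. passage_time X Y u \<omega> < ereal t} \<in> sets M"
proof -
  have "{\<omega> \<in> space M. passage_time X Y u \<omega> < ereal t} =
    {\<omega> \<in> space M. \<exists>r\<in>dyadics. \<exists>s\<in>dyadics. r \<le> s \<and> s < t \<and> u < X s \<omega> - X r \<omega> + Y r \<omega>}"
    using X Y by (intro Collect_cong conj_cong passage_time_less_iff refl) (auto simp: levy_process_def)
  also have "\<dots> \<in> sets M"
  proof (intro sets.sets_Collect_countable_Ex' sets.sets_Collect_conj sets.sets_Collect_const countable_dyadics)
    fix r s assume "r \<in> dyadics" "s \<in> dyadics"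
    then have [measurable]: "X s \<in> borel_measurable M" "X r \<in> borel_measurable M" "Y r \<in> borel_measurable M"
      using X Y dyadics_nonneg by (auto simp: levy_process_def)
    show "{\<omega> \<in> space M. u < X s \<omega> - X r \<omega> + Y r \<omega>} \<in> sets M" by measurable
  qed
  finally show ?thesis .
qed

lemma passage_time_le_event: "{\<omega> \<in> space M. passage_time X Y u \<omega> \<le> ereal t} \<in> sets M"
proof -
  have "{\<omega> \<in> space M. passage_time X Y u \<omega> \<le> ereal t} =
    {\<omega> \<in> space M. \<forall>n::nat. passage_time X Y u \<omega> < ereal (t + 1 / Suc n)}"
  proof (intro Collect_cong conj_cong refl iffI allI)
    fix \<omega> and n :: nat assume "passage_time X Y u \<omega> \<le> ereal t"
    also have "ereal t < ereal (t + 1 / Suc n)" by simp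
    finally show "passage_time X Y u \<omega> < ereal (t + 1 / Suc n)" .
  next
    fix \<omega> assume *: "\<forall>n::nat. passage_time X Y u \<omega> < ereal (t + 1 / Suc n)"
    show "passage_time X Y u \<omega> \<le> ereal t"
    proof (rule ereal_le_epsilon2)
      fix e :: real assume "0 < e"
      then obtain n where "1 / real (Suc n) < e" using nat_approx_posE by blast
      then have "ereal (t + 1 / Suc n) \<le> ereal t + ereal e" by simp
      with * show "passage_time X Y u \<omega> \<le> ereal t + ereal e"
        by (meson less_le_trans less_imp_le)
    qed
  qed
  also have "\<dots> \<in> sets M"
    by (intro sets.sets_Collect_countable_All passage_time_less_event)
  finally show ?thesis .
qed

end

subsection \<open>Uniform convergence to the normal distribution function\<close>

text \<open>Polya's theorem. On a short interval monotonicity traps both functions between their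
  endpoint values; Bolzano's principle takes the place of a finite partition, and the limits 0 and 1
  settle the tails. The filter is arbitrary because both integers \<open>n\<close> and real levels
  \<open>u\<close> occur as index.\<close>

lemma uniform_convergence_of_monotone_functions:
  fixes F :: "'i \<Rightarrow> real \<Rightarrow> real" and H :: "real \<Rightarrow> real"
  assumes mono: "\<And>i. mono (F i)" "mono H"
    and range: "\<And>i x. 0 \<le> F i x" "\<And>i x. F i x \<le> 1" "\<And>x. 0 \<le> H x" "\<And>x. H x \<le> 1"
    and lim: "\<And>x. ((\<lambda>i. F i x) \<longlongrightarrow> H x) G"
    and cont: "continuous_on UNIV H" and top: "(H \<longlongrightarrow> 1) at_top" and bot: "(H \<longlongrightarrow> 0) at_bot"
    and e: "e > 0"
  shows "\<forall>\<^sub>F i in G. \<forall>x. \<bar>F i x - H x\<bar> < e"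
proof -
  have close: "\<forall>\<^sub>F i in G. \<bar>F i x - H x\<bar> < e / 2" for x
    using tendstoD[OF lim[of x], of "e / 2"] e by (simp add: dist_real_def)
  define P where "P a b \<longleftrightarrow> (\<forall>\<^sub>F i in G. \<forall>x\<in>{a..b}. \<bar>F i x - H x\<bar> < e)" for a b
  obtain b where b: "0 \<le> b" "H b > 1 - e / 2"
  proof -
    have "\<forall>\<^sub>F x in at_top. 0 \<le> x \<and> H x > 1 - e / 2"
      using order_tendstoD(1)[OF top, of "1 - e / 2"] e by (intro eventually_conj eventually_ge_at_top) auto
    then show ?thesis using that eventually_happens' trivial_limit_at_top_linorder by blast
  qed
  obtain a where a: "a \<le> 0" "H a < e / 2"
  proof -
    have "\<forall>\<^sub>F x in at_bot. x \<le> 0 \<and> H x < e / 2"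
      using order_tendstoD(2)[OF bot, of "e / 2"] e by (intro eventually_conj eventually_le_at_bot) auto
    then show ?thesis using that eventually_happens' trivial_limit_at_bot_linorder by blast
  qed
  have "P a b"
  proof (rule Bolzano)
    show "a \<le> b" using a b by simp
  next
    fix a b c assume "P a b" "P b c"
    then show "P a c" unfolding P_def
    proof eventually_elim
      case (elim i)
      then show ?case by (metis atLeastAtMost_iff linear)
    qed
  next
    fix x
    have "isCont H x" using cont by (simp add: continuous_on_eq_continuous_at)
    then obtain d where d: "d > 0" "\<And>y. \<bar>y - x\<bar> < d \<Longrightarrow> \<bar>H y - H x\<bar> < e / 4"
      using e unfolding continuous_at_eps_delta dist_real_def by (metis zero_less_divide_iff zero_less_numeral)
    have "P a b" if ab: "a \<le> x" "x \<le> b" "b - a < d" for a b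
      unfolding P_def using close[of a] close[of b]
    proof eventually_elim
      case (elim i)
      show ?case
      proof
        fix y assume y: "y \<in> {a..b}"
        have "\<bar>H a - H x\<bar> < e / 4" "\<bar>H b - H x\<bar> < e / 4"
          by (rule d(2), use ab in linarith)+
        \<comment> \<open>\<open>F i y - H y\<close> lies between \<open>F i a - H b\<close> and
          \<open>F i b - H a\<close>. The endpoint error costs \<open>e / 2\<close> and the
          oscillation of \<open>H\<close> less than another \<open>e / 2\<close>.\<close>
        moreover have "H a \<le> H y" "H y \<le> H b" "F i a \<le> F i y" "F i y \<le> F i b"
          using y by (auto intro: monoD[OF mono(1)] monoD[OF mono(2)])
        ultimately show "\<bar>F i y - H y\<bar> < e" using elim by linarith
      qed
    qed
    with d(1) show "\<exists>d>0. \<forall>a b. a \<le> x \<and> x \<le> b \<and> b - a < d \<longrightarrow> P a b" by blast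
  qed
  then show ?thesis unfolding P_def using close[of a] close[of b]
  proof eventually_elim
    case (elim i)
    show ?case
    proof
      fix x
      consider "x < a" | "x \<in> {a..b}" | "b < x" by force
      then show "\<bar>F i x - H x\<bar> < e"
      proof cases
        \<comment> \<open>Both values lie in \<open>[0, e)\<close>, because
          \<open>H x \<le> H a < e / 2\<close> and
          \<open>F i x \<le> F i a < H a + e / 2\<close>.\<close>
        case 1
        then have "H x \<le> H a" "F i x \<le> F i a" by (auto intro: monoD[OF mono(1)] monoD[OF mono(2)])
        then show ?thesis using elim(2) a range(1,2)[of i x] range(3,4)[of x] by linarith
      next
        case 3
        then have "H b \<le> H x" "F i b \<le> F i x" by (auto intro: monoD[OF mono(1)] monoD[OF mono(2)])
        then show ?thesis using elim(3) b range(1,2)[of i x] range(3,4)[of x] by linarith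
      qed (use elim in auto)
    qed
  qed
qed

abbreviation std_normal_cdf :: "real \<Rightarrow> real" where
  "std_normal_cdf y \<equiv> measure std_normal_distribution {z. z \<le> y}"

lemma std_normal_cdf_eq: "std_normal_cdf = cdf std_normal_distribution"
  by (simp add: cdf_def atMost_def fun_eq_iff)

lemma measure_std_normal_singleton: "measure std_normal_distribution {y} = 0"
proof -
  have "emeasure std_normal_distribution {y} = 0"
    by (simp add: emeasure_density nn_integral_null_delta)
  then show ?thesis by (simp add: measure_def)
qed

lemma isCont_std_normal_cdf: "isCont std_normal_cdf y"
proof -
  interpret std_normal: real_distribution std_normal_distribution
    by (rule real_dist_normal_dist)
  show ?thesis
    unfolding std_normal_cdf_eq std_normal.isCont_cdf by (rule measure_std_normal_singleton)
qed

lemma mono_std_normal_cdf: "mono std_normal_cdf"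
proof -
  interpret std_normal: real_distribution std_normal_distribution
    by (rule real_dist_normal_dist)
  show ?thesis
    unfolding std_normal_cdf_eq by (simp add: mono_def std_normal.cdf_nondecreasing)
qed

text \<open>Reflection preserves the law and points carry no mass. This turns limits of exceedance
  probabilities back into values of the distribution function.\<close>

lemma std_normal_cdf_uminus: "std_normal_cdf (- y) = 1 - std_normal_cdf y"
proof -
  interpret std_normal: real_distribution std_normal_distribution
    by (rule real_dist_normal_dist)
  have "distributed std_normal_distribution lborel (\<lambda>x. x) std_normal_density"
    unfolding distributed_def by (auto intro!: distr_id2)
  from std_normal.normal_density_affine[OF this, of "-1" 0]
  have "distr std_normal_distribution lborel uminus = std_normal_distribution"
    by (simp add: distributed_def)
  then have "std_normal_cdf (- y) = measure (distr std_normal_distribution lborel uminus) {z. z \<le> - y}"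
    by simp
  also have "\<dots> = measure std_normal_distribution {z. y \<le> z}"
    by (subst measure_distr) (auto simp: vimage_def)
  also have "\<dots> = measure std_normal_distribution {z. y < z}"
  proof -
    have "{z. y \<le> z} = {y} \<union> {z. y < z}" by auto
    then show ?thesis
      by (simp add: std_normal.finite_measure_Union measure_std_normal_singleton del: Un_insert_left)
  qed
  also have "{z. y < z} = space std_normal_distribution - {z. z \<le> y}" by auto
  also have "measure std_normal_distribution \<dots> = 1 - std_normal_cdf y"
    by (rule std_normal.prob_compl) simp
  finally show ?thesis .
qed

text \<open>A null left tail would make the positive density vanish almost everywhere on an interval
  of length 1. Positivity is what permits division in the asymptotic equivalence.\<close>

lemma std_normal_cdf_pos: "0 < std_normal_cdf y"
proof (rule ccontr)
  interpret std_normal: real_distribution std_normal_distribution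
    by (rule real_dist_normal_dist)
  assume "\<not> 0 < std_normal_cdf y"
  then have "emeasure std_normal_distribution {..y} = 0"
    by (simp add: std_normal.emeasure_eq_measure atMost_def order.antisym)
  then have "(\<integral>\<^sup>+x. ennreal (std_normal_density x) * indicator {..y} x \<partial>lborel) = 0"
    by (simp add: emeasure_density)
  then have "AE x in lborel. ennreal (std_normal_density x) * indicator {..y} x = 0"
    by (subst (asm) nn_integral_0_iff_AE) auto
  then have "AE x in lborel. x \<notin> {y - 1..y}"
  proof eventually_elim
    case (elim x)
    moreover have "std_normal_density x > 0" by (rule normal_density_pos) simp
    ultimately show ?case by (auto simp: indicator_def split: if_splits)
  qed
  then have "emeasure lborel {y - 1..y} = 0"
    by (subst (asm) AE_iff_measurable[where N = "{y - 1..y}"]) auto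
  then show False by simp
qed

lemma uniform_convergence_std_normal_cdf:
  fixes F :: "'i \<Rightarrow> real \<Rightarrow> real"
  assumes "\<And>i. mono (F i)" "\<And>i x. 0 \<le> F i x" "\<And>i x. F i x \<le> 1"
    and "\<And>x. ((\<lambda>i. F i x) \<longlongrightarrow> std_normal_cdf x) G" and "e > 0"
  shows "\<forall>\<^sub>F i in G. \<forall>x. \<bar>F i x - std_normal_cdf x\<bar> < e"
proof (rule uniform_convergence_of_monotone_functions)
  interpret std_normal: real_distribution std_normal_distribution
    by (rule real_dist_normal_dist)
  show "continuous_on UNIV std_normal_cdf"
    by (simp add: continuous_on_eq_continuous_at isCont_std_normal_cdf)
  show "(std_normal_cdf \<longlongrightarrow> 1) at_top"
    unfolding std_normal_cdf_eq by (rule std_normal.cdf_lim_at_top_prob)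
  show "(std_normal_cdf \<longlongrightarrow> 0) at_bot"
    unfolding std_normal_cdf_eq by (rule std_normal.cdf_lim_at_bot)
  show "std_normal_cdf x \<le> 1" for x by (rule std_normal.prob_le_1)
qed (use assms mono_std_normal_cdf in auto)

text \<open>Index and argument move together with \<open>u\<close>, so pointwise convergence is not
  enough; uniform convergence and continuity of the limit are combined.\<close>

lemma tendsto_std_normal_cdf_compose:
  fixes F :: "nat \<Rightarrow> real \<Rightarrow> real"
  assumes F: "\<And>n. mono (F n)" "\<And>n x. 0 \<le> F n x" "\<And>n x. F n x \<le> 1"
    and lim: "\<And>x. (\<lambda>n. F n x) \<longlonglongrightarrow> std_normal_cdf x"
    and N: "filterlim N sequentially G" and y: "(y \<longlongrightarrow> c) G"
  shows "((\<lambda>u. F (N u) (y u)) \<longlongrightarrow> std_normal_cdf c) G"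
proof (rule tendstoI)
  fix e :: real assume e: "e > 0"
  have "\<forall>\<^sub>F u in G. \<forall>x. \<bar>F (N u) x - std_normal_cdf x\<bar> < e / 2"
    using uniform_convergence_std_normal_cdf[where F = F, OF F lim, of "e / 2"] e N
    by (auto simp: filterlim_iff)
  moreover have "((\<lambda>u. std_normal_cdf (y u)) \<longlongrightarrow> std_normal_cdf c) G"
    by (rule isCont_tendsto_compose[OF isCont_std_normal_cdf y])
  then have "\<forall>\<^sub>F u in G. dist (std_normal_cdf (y u)) (std_normal_cdf c) < e / 2"
    using e by (intro tendstoD) auto
  ultimately show "\<forall>\<^sub>F u in G. dist (F (N u) (y u)) (std_normal_cdf c) < e"
  proof eventually_elim
    case (elim u)
    then show ?case using elim(1)[rule_format, of "y u"] unfolding dist_real_def by linarith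
  qed
qed

subsection \<open>From the limit theorem to passage times\<close>

text \<open>This is where \<open>m ^ 3\<close> comes from: \<open>N u\<close> is about
  \<open>u / m\<close>, so the fluctuation in height is of order \<open>sqrt (u * v / m)\<close>,
  and dividing by the slope \<open>m\<close> converts it into time. A bounded error in
  \<open>N\<close>, such as rounding to an integer, disappears on the scale \<open>sqrt u\<close>,
  whereas lowering the level by \<open>b * sqrt (N u)\<close> moves the limit by
  \<open>- b / sqrt v\<close>.\<close>

lemma tendsto_normalised_level:
  fixes m v x :: real and N :: "real \<Rightarrow> real"
  assumes m: "m > 0" and v: "v > 0"
    and N: "\<And>u. \<bar>N u - (u / m + x * sqrt (u * v / m ^ 3))\<bar> \<le> C"
  shows "filterlim N at_top at_top"
    and "((\<lambda>u. (u - b * sqrt (N u) - m * N u) / sqrt (N u * v)) \<longlongrightarrow> - x - b / sqrt v) at_top"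
proof -
  let ?t = "\<lambda>u. u / m + x * sqrt (u * v / m ^ 3)"
  define d where "d u = N u - ?t u" for u
  have d: "\<bar>d u\<bar> \<le> C" for u using N by (simp add: d_def)
  have Nd: "N u = ?t u + d u" for u by (simp add: d_def)
  define k where "k = sqrt (v / m ^ 3)"
  have t: "?t u = u / m + x * k * sqrt u" for u
    by (simp add: k_def real_sqrt_mult real_sqrt_divide)
  have dsmall: "((\<lambda>u. d u / sqrt u) \<longlongrightarrow> 0) at_top"
  proof (rule Lim_null_comparison)
    show "\<forall>\<^sub>F u in at_top. norm (d u / sqrt u) \<le> C / sqrt u"
      using eventually_gt_at_top[of 0]
      by eventually_elim (use d in \<open>auto intro!: divide_right_mono\<close>)
    show "((\<lambda>u. C / sqrt u) \<longlongrightarrow> 0) at_top" by real_asymp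
  qed
  have Nu: "((\<lambda>u. N u / u) \<longlongrightarrow> 1 / m) at_top"
  proof (rule Lim_transform_eventually)
    have "((\<lambda>u. 1 / m + x * k * (1 / sqrt u) + d u / sqrt u * (1 / sqrt u)) \<longlongrightarrow> 1 / m + x * k * 0 + 0 * 0) at_top"
      by (intro tendsto_intros dsmall) real_asymp+
    then show "((\<lambda>u. 1 / m + x * k * (1 / sqrt u) + d u / sqrt u * (1 / sqrt u)) \<longlongrightarrow> 1 / m) at_top"
      by simp
    show "\<forall>\<^sub>F u in at_top. 1 / m + x * k * (1 / sqrt u) + d u / sqrt u * (1 / sqrt u) = N u / u"
      using eventually_gt_at_top[of 0]
    proof eventually_elim
      case (elim u)
      have s: "sqrt u / u = 1 / sqrt u" using elim by (simp add: real_div_sqrt field_simps)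
      have "N u / u = 1 / m + x * k * (sqrt u / u) + d u / u"
        using elim m by (simp add: Nd t add_divide_distrib)
      also have "d u / u = d u / sqrt u * (1 / sqrt u)" using elim by simp
      finally show ?case unfolding s by simp
    qed
  qed
  have "filterlim (\<lambda>u. N u / u * u) at_top at_top"
    by (rule filterlim_tendsto_pos_mult_at_top[OF Nu _ filterlim_ident]) (use m in simp)
  then show Ninf: "filterlim N at_top at_top"
  proof (rule filterlim_cong[THEN iffD1, rotated 3])
    show "\<forall>\<^sub>F u in at_top. N u / u * u = N u"
      using eventually_gt_at_top[of 0] by eventually_elim auto
  qed auto
  have num: "((\<lambda>u. (u - m * N u) / sqrt u) \<longlongrightarrow> - (m * x * k)) at_top"
  proof (rule Lim_transform_eventually)
    have "((\<lambda>u. - (m * x * k) - m * (d u / sqrt u)) \<longlongrightarrow> - (m * x * k) - m * 0) at_top"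
      by (intro tendsto_intros dsmall)
    then show "((\<lambda>u. - (m * x * k) - m * (d u / sqrt u)) \<longlongrightarrow> - (m * x * k)) at_top" by simp
    show "\<forall>\<^sub>F u in at_top. - (m * x * k) - m * (d u / sqrt u) = (u - m * N u) / sqrt u"
      using eventually_gt_at_top[of 0]
    proof eventually_elim
      case (elim u)
      have "u - m * N u = - (m * x * k) * sqrt u - m * d u"
        using m by (simp add: Nd t algebra_simps)
      then show ?case using elim by (simp add: diff_divide_distrib)
    qed
  qed
  \<comment> \<open>Numerator and denominator are divided by \<open>sqrt u\<close>, so that each
    part converges by itself.\<close>
  have "((\<lambda>u. ((u - m * N u) / sqrt u - b * sqrt (N u / u)) / sqrt (N u / u * v))
      \<longlongrightarrow> (- (m * x * k) - b * sqrt (1 / m)) / sqrt (1 / m * v)) at_top"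
    using m v by (intro tendsto_intros num Nu) auto
  moreover have "(- (m * x * k) - b * sqrt (1 / m)) / sqrt (1 / m * v) = - x - b / sqrt v"
  proof -
    have "m * k = sqrt (m\<^sup>2 * (v / m ^ 3))" unfolding k_def real_sqrt_mult using m by simp
    also have "m\<^sup>2 * (v / m ^ 3) = 1 / m * v" using m by (simp add: power2_eq_square power3_eq_cube)
    finally have "m * x * k = x * sqrt (1 / m * v)" by (simp add: mult_ac)
    moreover have "sqrt (1 / m * v) = sqrt (1 / m) * sqrt v" by (rule real_sqrt_mult)
    ultimately have "(- (m * x * k) - b * sqrt (1 / m)) / sqrt (1 / m * v)
        = (- (x * (sqrt (1 / m) * sqrt v)) - b * sqrt (1 / m)) / (sqrt (1 / m) * sqrt v)"
      by (simp only:)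
    also have "(- (x * (p * q)) - b * p) / (p * q) = - x - b / q" if "p > 0" "q > 0" for p q :: real
      using that by (simp add: field_simps)
    then have "(- (x * (sqrt (1 / m) * sqrt v)) - b * sqrt (1 / m)) / (sqrt (1 / m) * sqrt v) = - x - b / sqrt v"
      using m v by simp
    finally show ?thesis .
  qed
  ultimately have "((\<lambda>u. ((u - m * N u) / sqrt u - b * sqrt (N u / u)) / sqrt (N u / u * v))
      \<longlongrightarrow> - x - b / sqrt v) at_top"
    by (simp only:)
  then show "((\<lambda>u. (u - b * sqrt (N u) - m * N u) / sqrt (N u * v)) \<longlongrightarrow> - x - b / sqrt v) at_top"
  proof (rule Lim_transform_eventually)
    show "\<forall>\<^sub>F u in at_top. ((u - m * N u) / sqrt u - b * sqrt (N u / u)) / sqrt (N u / u * v)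
        = (u - b * sqrt (N u) - m * N u) / sqrt (N u * v)"
      using eventually_gt_at_top[of 0]
    proof eventually_elim
      case (elim u)
      then have "(u - m * N u) / sqrt u - b * sqrt (N u / u) = (u - b * sqrt (N u) - m * N u) / sqrt u"
        by (simp add: real_sqrt_divide diff_divide_distrib)
      moreover have "sqrt (N u / u * v) = sqrt (N u * v) / sqrt u"
        by (simp add: real_sqrt_divide[symmetric])
      ultimately show ?case using elim by simp
    qed
  qed
qed

context prob_space
begin

lemma mono_prob_le: "(\<And>t. {\<omega> \<in> space M. f \<omega> \<le> t} \<in> events) \<Longrightarrow> mono (\<lambda>t. prob {\<omega> \<in> space M. f \<omega> \<le> (t::real)})"
  by (intro monoI finite_measure_mono) auto

text \<open>Shared by both drift regimes, with \<open>A\<close> sampled from \<open>X\<close> or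
  from \<open>Y\<close>. With \<open>N\<close> the integer part of \<open>t\<close>, the event
  \<open>T u \<le> t\<close> lies between \<open>T u \<le> N\<close> and \<open>T u < N + 1\<close>,
  which is why \<open>lower\<close> concerns a closed and \<open>upper\<close> an open
  event.\<close>

lemma passage_pointwise_limit:
  fixes A :: "nat \<Rightarrow> 'a \<Rightarrow> real" and T :: "real \<Rightarrow> 'a \<Rightarrow> ereal" and m v :: real
  assumes m: "m > 0" and v: "v > 0"
    and A[measurable]: "\<And>n. A n \<in> borel_measurable M"
    and clt: "\<And>y. (\<lambda>n. prob {\<omega> \<in> space M. (A n \<omega> - m * n) / sqrt (n * v) \<le> y}) \<longlonglongrightarrow> std_normal_cdf y"
    and T_le: "\<And>u t. {\<omega> \<in> space M. T u \<omega> \<le> ereal t} \<in> events"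
    and T_less: "\<And>u t. {\<omega> \<in> space M. T u \<omega> < ereal t} \<in> events"
    and lower: "\<And>u n. prob {\<omega> \<in> space M. u < A n \<omega>} \<le> prob {\<omega> \<in> space M. T u \<omega> \<le> ereal (real n)}"
    and upper: "\<And>\<epsilon>. \<epsilon> > 0 \<Longrightarrow> \<exists>\<delta>. \<delta> \<longlonglongrightarrow> 0 \<and> (\<forall>u n. prob {\<omega> \<in> space M. T u \<omega> < ereal (real n)}
        \<le> prob {\<omega> \<in> space M. u - \<epsilon> * sqrt n < A n \<omega>} + \<delta> n)"
  shows "((\<lambda>u. prob {\<omega> \<in> space M. T u \<omega> \<le> ereal (u / m + x * sqrt (u * v / m ^ 3))})
    \<longlongrightarrow> std_normal_cdf x) at_top"
proof -
  define t where "t u = u / m + x * sqrt (u * v / m ^ 3)" for u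
  define F where "F n y = prob {\<omega> \<in> space M. (A n \<omega> - m * n) / sqrt (n * v) \<le> y}" for n y
  define p where "p u = prob {\<omega> \<in> space M. T u \<omega> \<le> ereal (t u)}" for u
  have F: "mono (F n)" "0 \<le> F n y" "F n y \<le> 1" for n y
    unfolding F_def by (auto intro!: mono_prob_le)
  have F_lim: "(\<lambda>n. F n y) \<longlonglongrightarrow> std_normal_cdf y" for y unfolding F_def by (rule clt)
  have exceed: "prob {\<omega> \<in> space M. w < A n \<omega>} = 1 - F n ((w - m * n) / sqrt (n * v))" if "n > 0" for w n
  proof -
    have "{\<omega> \<in> space M. w < A n \<omega>} = space M - {\<omega> \<in> space M. (A n \<omega> - m * n) / sqrt (n * v) \<le> (w - m * n) / sqrt (n * v)}"
      using that v by (auto simp: divide_le_cancel mult_less_0_iff)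
    then show ?thesis unfolding F_def by (simp add: prob_compl)
  qed
  define N where "N u = nat \<lfloor>max 0 (t u)\<rfloor>" for u
  have "filterlim t at_top at_top"
    unfolding t_def by (rule tendsto_normalised_level(1)[OF m v, where x = x and C = 0]) simp
  then have t_pos: "\<forall>\<^sub>F u in at_top. 1 \<le> t u" by (simp add: filterlim_at_top)
  \<comment> \<open>Used with \<open>b = 0\<close>, \<open>j = 0\<close> for the lower bound and
    with \<open>b > 0\<close>, \<open>j = 1\<close> for the upper one.\<close>
  have exceed_lim: "((\<lambda>u. prob {\<omega> \<in> space M. u - b * sqrt (real (N u + j)) < A (N u + j) \<omega>})
      \<longlongrightarrow> std_normal_cdf (x + b / sqrt v)) at_top" for b and j :: nat
  proof -
    \<comment> \<open>\<open>tendsto_normalised_level\<close> demands closeness to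
      \<open>t u\<close> for every \<open>u\<close>, but \<open>N u\<close> truncates at 0 and may
      be far away where \<open>t u\<close> is negative. \<open>R\<close> is repaired there and
      eventually equals \<open>N u + j\<close>.\<close>
    define R where "R u = (if 1 \<le> t u then real (N u + j) else t u)" for u
    have R: "\<bar>R u - (u / m + x * sqrt (u * v / m ^ 3))\<bar> \<le> 1 + real j" for u
    proof (cases "1 \<le> t u")
      case True
      then have "real (N u) = of_int \<lfloor>t u\<rfloor>" by (simp add: N_def max_def)
      then show ?thesis using True unfolding R_def t_def[symmetric] by simp linarith
    qed (simp add: R_def t_def)
    have R_eq: "\<forall>\<^sub>F u in at_top. R u = real (N u + j)"
      using t_pos by eventually_elim (simp add: R_def)
    have R_top: "filterlim R at_top at_top" by (rule tendsto_normalised_level(1)[OF m v R])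
    then have "filterlim (\<lambda>u. real (N u + j)) at_top at_top"
      by (rule filterlim_cong[OF refl refl R_eq, THEN iffD1])
    then have N_lim: "filterlim (\<lambda>u. N u + j) sequentially at_top"
      by (simp only: filterlim_sequentially_iff_filterlim_real)
    have "((\<lambda>u. (u - b * sqrt (R u) - m * R u) / sqrt (R u * v)) \<longlongrightarrow> - x - b / sqrt v) at_top"
      by (rule tendsto_normalised_level(2)[OF m v R])
    then have y: "((\<lambda>u. (u - b * sqrt (real (N u + j)) - m * real (N u + j)) / sqrt (real (N u + j) * v)) \<longlongrightarrow> - x - b / sqrt v) at_top"
      by (rule Lim_transform_eventually) (use R_eq in \<open>eventually_elim, simp\<close>)
    have "((\<lambda>u. 1 - F (N u + j) ((u - b * sqrt (real (N u + j)) - m * real (N u + j)) / sqrt (real (N u + j) * v)))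
        \<longlongrightarrow> 1 - std_normal_cdf (- x - b / sqrt v)) at_top"
      by (intro tendsto_diff tendsto_const tendsto_std_normal_cdf_compose[OF F F_lim N_lim y])
    also have "1 - std_normal_cdf (- x - b / sqrt v) = std_normal_cdf (x + b / sqrt v)"
      using std_normal_cdf_uminus[of "- x - b / sqrt v"] by (simp add: add.commute)
    finally show ?thesis
    proof (rule Lim_transform_eventually)
      have "\<forall>\<^sub>F u in at_top. 0 < N u + j"
        using N_lim eventually_gt_at_top[of 0] unfolding filterlim_iff by blast
      then show "\<forall>\<^sub>F u in at_top. 1 - F (N u + j) ((u - b * sqrt (real (N u + j)) - m * real (N u + j)) / sqrt (real (N u + j) * v))
          = prob {\<omega> \<in> space M. u - b * sqrt (real (N u + j)) < A (N u + j) \<omega>}"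
        by eventually_elim (simp add: exceed)
    qed
  qed
  have N_top: "filterlim (\<lambda>u. N u + 1) sequentially at_top"
  proof -
    have "filterlim (\<lambda>u. nat \<lfloor>t u\<rfloor>) sequentially at_top"
      using \<open>filterlim t at_top at_top\<close>
      by (intro filterlim_compose[OF filterlim_nat_sequentially] filterlim_compose[OF filterlim_floor_sequentially])
    then have "filterlim N sequentially at_top"
      by (rule filterlim_cong[OF refl refl, THEN iffD1, rotated])
        (use t_pos in \<open>eventually_elim, simp add: N_def max_def\<close>)
    then show ?thesis by (rule filterlim_compose[OF filterlim_add_const_nat_at_top])
  qed
  have "(p \<longlongrightarrow> std_normal_cdf x) at_top"
  proof (rule order_tendstoI)
    fix a assume a: "a < std_normal_cdf x"
    have "\<forall>\<^sub>F u in at_top. a < prob {\<omega> \<in> space M. u - 0 * sqrt (real (N u + 0)) < A (N u + 0) \<omega>}"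
      using a by (intro order_tendstoD(1)[OF exceed_lim]) simp
    with t_pos show "\<forall>\<^sub>F u in at_top. a < p u"
    proof eventually_elim
      case (elim u)
      have "real (N u) \<le> t u" using elim by (simp add: N_def max_def)
      then have "prob {\<omega> \<in> space M. T u \<omega> \<le> ereal (real (N u))} \<le> p u"
        unfolding p_def by (intro finite_measure_mono T_le) (auto intro: order_trans)
      then show ?case using elim lower[of u "N u"] by simp
    qed
  next
    fix a assume a: "std_normal_cdf x < a"
    \<comment> \<open>The level error \<open>b * sqrt n\<close> shifts the limit to the value at
      \<open>x + b / sqrt v\<close>; by continuity a small \<open>b > 0\<close> keeps this below
      \<open>a\<close>.\<close>
    have "((\<lambda>b. std_normal_cdf (x + b / sqrt v)) \<longlongrightarrow> std_normal_cdf (x + 0 / sqrt v)) (at_right 0)"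
      using v by (intro isCont_tendsto_compose[OF isCont_std_normal_cdf] tendsto_intros) auto
    then have "\<forall>\<^sub>F b in at_right 0. std_normal_cdf (x + b / sqrt v) < a"
      using a by (intro order_tendstoD(2)) auto
    then obtain b where b: "b > 0" "std_normal_cdf (x + b / sqrt v) < a"
      unfolding eventually_at_right_field by (metis dense)
    obtain \<delta> where \<delta>: "\<delta> \<longlonglongrightarrow> 0"
      "\<And>u n. prob {\<omega> \<in> space M. T u \<omega> < ereal (real n)} \<le> prob {\<omega> \<in> space M. u - b * sqrt n < A n \<omega>} + \<delta> n"
      using upper[OF b(1)] by blast
    have "((\<lambda>u. prob {\<omega> \<in> space M. u - b * sqrt (real (N u + 1)) < A (N u + 1) \<omega>} + \<delta> (N u + 1))
        \<longlongrightarrow> std_normal_cdf (x + b / sqrt v) + 0) at_top"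
      by (intro tendsto_add exceed_lim filterlim_compose[OF \<delta>(1) N_top])
    then have "\<forall>\<^sub>F u in at_top. prob {\<omega> \<in> space M. u - b * sqrt (real (N u + 1)) < A (N u + 1) \<omega>} + \<delta> (N u + 1) < a"
      using b(2) by (intro order_tendstoD(2)) auto
    with t_pos show "\<forall>\<^sub>F u in at_top. p u < a"
    proof eventually_elim
      case (elim u)
      have "t u < real (N u + 1)" using elim(1) by (simp add: N_def max_def) linarith
      then have "p u \<le> prob {\<omega> \<in> space M. T u \<omega> < ereal (real (N u + 1))}"
        unfolding p_def by (intro finite_measure_mono T_less) (auto intro: le_less_trans)
      also have "\<dots> \<le> prob {\<omega> \<in> space M. u - b * sqrt (real (N u + 1)) < A (N u + 1) \<omega>} + \<delta> (N u + 1)"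
        by (rule \<delta>(2))
      also have "\<dots> < a" by (rule elim(2))
      finally show ?case .
    qed
  qed
  then show ?thesis unfolding p_def t_def .
qed

lemma normalised_event_eq:
  fixes T :: "'a \<Rightarrow> ereal"
  assumes "s > 0"
  shows "{\<omega> \<in> space M. T \<omega> \<le> ereal r} =
    {\<omega> \<in> space M. (T \<omega> - ereal c) / ereal s \<le> ereal ((r - c) / s)}"
proof -
  have "a \<le> ereal r \<longleftrightarrow> (a - ereal c) / ereal s \<le> ereal ((r - c) / s)" for a
    using assms by (cases a) (auto simp: divide_le_cancel)
  then show ?thesis by simp
qed

text \<open>Uniformity in \<open>x\<close> allows the normalised \<open>g u\<close> to be
  substituted for \<open>x\<close>, which gives the difference. For the ratio the denominator must
  stay away from 0; the lower bound \<open>K\<close> ensures this.\<close>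

lemma passage_uniform_conclusion:
  fixes T :: "real \<Rightarrow> 'a \<Rightarrow> ereal" and g :: "real \<Rightarrow> real" and m v :: real
  assumes m: "m > 0" and v: "v > 0"
    and T_le: "\<And>u t. {\<omega> \<in> space M. T u \<omega> \<le> ereal t} \<in> events"
    and lim: "\<And>x. ((\<lambda>u. prob {\<omega> \<in> space M. T u \<omega> \<le> ereal (u / m + x * sqrt (u * v / m ^ 3))})
      \<longlongrightarrow> std_normal_cdf x) at_top"
  shows "(\<forall>u>0. prob {\<omega> \<in> space M. T u \<omega> \<le> ereal (g u)} =
          prob {\<omega> \<in> space M.
            (T u \<omega> - ereal (u / m)) / ereal (sqrt (u * v / m ^ 3))
              \<le> ereal ((g u - u / m) / sqrt (u * v / m ^ 3))}) \<and>
       ((\<exists>K. \<forall>\<^sub>F u in at_top. K \<le> (g u - u / m) / sqrt (u * v / m ^ 3)) \<longrightarrow>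
          (\<lambda>u. prob {\<omega> \<in> space M. T u \<omega> \<le> ereal (g u)})
            \<sim>[at_top]
          (\<lambda>u. std_normal_cdf ((g u - u / m) / sqrt (u * v / m ^ 3)))) \<and>
       ((\<lambda>u. prob {\<omega> \<in> space M. T u \<omega> \<le> ereal (g u)}
            - std_normal_cdf ((g u - u / m) / sqrt (u * v / m ^ 3))) \<longlongrightarrow> 0) at_top"
proof (intro conjI impI allI)
  fix u :: real assume "u > 0"
  then show "prob {\<omega> \<in> space M. T u \<omega> \<le> ereal (g u)} =
      prob {\<omega> \<in> space M. (T u \<omega> - ereal (u / m)) / ereal (sqrt (u * v / m ^ 3))
        \<le> ereal ((g u - u / m) / sqrt (u * v / m ^ 3))}"
    using m v by (intro arg_cong[where f = prob] normalised_event_eq) simp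
next
  let ?p = "\<lambda>u. prob {\<omega> \<in> space M. T u \<omega> \<le> ereal (g u)}"
  let ?x = "\<lambda>u. (g u - u / m) / sqrt (u * v / m ^ 3)"
  \<comment> \<open>\<open>F u\<close> must be monotone for every \<open>u\<close>, but
    \<open>sqrt\<close> is an odd function and would be negative for \<open>u < 0\<close>; hence
    \<open>\<bar>u\<bar>\<close>, which changes nothing for \<open>u > 0\<close>.\<close>
  define F where "F u x = prob {\<omega> \<in> space M. T u \<omega> \<le> ereal (u / m + x * sqrt (\<bar>u\<bar> * v / m ^ 3))}" for u x
  have mono: "mono (F u)" for u
    unfolding F_def using m v
    by (intro monoI finite_measure_mono T_le) (auto elim!: order_trans intro!: mult_right_mono)
  have F_lim: "((\<lambda>u. F u x) \<longlongrightarrow> std_normal_cdf x) at_top" for x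
    by (rule Lim_transform_eventually[OF lim])
      (use eventually_gt_at_top[of 0] in \<open>eventually_elim, simp add: F_def\<close>)
  have unif: "\<forall>\<^sub>F u in at_top. \<forall>x. \<bar>F u x - std_normal_cdf x\<bar> < e" if "e > 0" for e
    by (rule uniform_convergence_std_normal_cdf[where F = F, OF mono _ _ F_lim that]) (simp_all add: F_def)
  show diff: "((\<lambda>u. ?p u - std_normal_cdf (?x u)) \<longlongrightarrow> 0) at_top"
  proof (rule tendstoI)
    fix e :: real assume "e > 0"
    from unif[OF this] eventually_gt_at_top[of 0]
    show "\<forall>\<^sub>F u in at_top. dist (?p u - std_normal_cdf (?x u)) 0 < e"
    proof eventually_elim
      case (elim u)
      have "sqrt (u * v / m ^ 3) > 0" using elim m v by simp
      then have "?x u * sqrt (u * v / m ^ 3) = g u - u / m"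
        by (metis less_irrefl nonzero_eq_divide_eq)
      then have "F u (?x u) = ?p u" unfolding F_def using elim by (simp only: abs_of_pos) simp
      then show ?case using elim(1)[rule_format, of "?x u"] by (simp add: dist_real_def)
    qed
  qed
  assume "\<exists>K. \<forall>\<^sub>F u in at_top. K \<le> ?x u"
  then obtain K where K: "\<forall>\<^sub>F u in at_top. K \<le> ?x u" by blast
  have "((\<lambda>u. ?p u / std_normal_cdf (?x u) - 1) \<longlongrightarrow> 0) at_top"
  proof (rule Lim_null_comparison)
    show "\<forall>\<^sub>F u in at_top. norm (?p u / std_normal_cdf (?x u) - 1)
        \<le> \<bar>?p u - std_normal_cdf (?x u)\<bar> / std_normal_cdf K"
      using K
    proof eventually_elim
      case (elim u)
      have "std_normal_cdf K \<le> std_normal_cdf (?x u)" using elim mono_std_normal_cdf by (auto dest: monoD)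
      moreover have "?p u / std_normal_cdf (?x u) - 1 = (?p u - std_normal_cdf (?x u)) / std_normal_cdf (?x u)"
        using std_normal_cdf_pos[of "?x u"] by (simp add: diff_divide_distrib)
      ultimately show ?case
        using std_normal_cdf_pos[of "?x u"] std_normal_cdf_pos[of K]
        by (auto simp: abs_divide intro!: divide_left_mono)
    qed
    show "((\<lambda>u. \<bar>?p u - std_normal_cdf (?x u)\<bar> / std_normal_cdf K) \<longlongrightarrow> 0) at_top"
      using tendsto_divide[OF tendsto_rabs[OF diff] tendsto_const[of "std_normal_cdf K"]] std_normal_cdf_pos[of K]
      by simp
  qed
  then have "((\<lambda>u. ?p u / std_normal_cdf (?x u)) \<longlongrightarrow> 1) at_top"
    by (simp only: LIM_zero_iff)
  then show "?p \<sim>[at_top] (\<lambda>u. std_normal_cdf (?x u))"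
    by (rule asymp_equivI')
qed

end

section \<open>Comparison with \<open>X n\<close> and \<open>Y n\<close> in the two drift
  regimes\<close>

lemma (in prob_space) prob_le_three_exceptions:
  assumes "AE \<omega> in M. P \<omega> \<longrightarrow> Q \<omega> \<or> A \<omega> \<or> B \<omega> \<or> C \<omega>"
    and ev: "{\<omega> \<in> space M. Q \<omega>} \<in> events" "{\<omega> \<in> space M. A \<omega>} \<in> events"
      "{\<omega> \<in> space M. B \<omega>} \<in> events" "{\<omega> \<in> space M. C \<omega>} \<in> events"
  shows "prob {\<omega> \<in> space M. P \<omega>} \<le> prob {\<omega> \<in> space M. Q \<omega>} +
    (prob {\<omega> \<in> space M. A \<omega>} + (prob {\<omega> \<in> space M. B \<omega>} + prob {\<omega> \<in> space M. C \<omega>}))"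
    (is "_ \<le> prob ?Q + (prob ?A + (prob ?B + prob ?C))")
proof -
  have "prob {\<omega> \<in> space M. P \<omega>} \<le> prob (?Q \<union> (?A \<union> (?B \<union> ?C)))"
    using assms(1) ev by (intro finite_measure_mono_AE sets.Un) (auto elim!: eventually_mono)
  also have "\<dots> \<le> prob ?Q + prob (?A \<union> (?B \<union> ?C))" by (intro measure_Un_le sets.Un ev)
  also have "prob (?A \<union> (?B \<union> ?C)) \<le> prob ?A + prob (?B \<union> ?C)" by (intro measure_Un_le sets.Un ev)
  also have "prob (?B \<union> ?C) \<le> prob ?B + prob ?C" by (intro measure_Un_le ev)
  finally show ?thesis by simp
qed

locale levy_pair = X: square_integrable_levy M X mX vX + Y: square_integrable_levy M Y mY vY
  for M :: "'a measure" and X mX vX Y mY vY +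
  assumes mX_pos: "mX > 0"
begin

abbreviation forward_dev where
  "forward_dev L m \<epsilon> \<eta> n \<omega> \<equiv> \<exists>q\<in>dyadics. q \<le> real n \<and>
    \<epsilon> * sqrt n + \<eta> * q \<le> \<bar>L q \<omega> - L 0 \<omega> - m * q\<bar>"

abbreviation reverse_dev where
  "reverse_dev L m \<epsilon> \<eta> n \<omega> \<equiv> \<exists>q\<in>dyadics. q \<le> real n \<and>
    \<epsilon> * sqrt n + \<eta> * (real n - q) \<le> \<bar>L (real n) \<omega> - L q \<omega> - m * (real n - q)\<bar>"

lemma cadlag_paths:
  "\<omega> \<in> space M \<Longrightarrow> cadlag (\<lambda>t. X t \<omega>)" "\<omega> \<in> space M \<Longrightarrow> cadlag (\<lambda>t. Y t \<omega>)"
  using X.levy Y.levy by (auto simp: levy_process_def)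

lemmas passage_events = passage_time_le_event[OF X.levy Y.levy] passage_time_less_event[OF X.levy Y.levy]

text \<open>
  For \<open>r \<le> s \<le> n\<close> write \<open>X s - X r + Y r = X n - (X n - X s) - (X r - Y r)\<close>.  The subtracted terms have
  positive drift in \<open>n - s\<close> and in \<open>r\<close>, which absorbs their fluctuations.
\<close>

lemma passage_limit_positive_drift:
  assumes drift: "mY < mX" and v: "vX > 0"
  shows "((\<lambda>u. X.prob {\<omega> \<in> space M. passage_time X Y u \<omega> \<le> ereal (u / mX + x * sqrt (u * vX / mX ^ 3))})
    \<longlongrightarrow> std_normal_cdf x) at_top"
proof (rule X.passage_pointwise_limit[OF mX_pos v _ X.central_limit_integer_times[OF v]])
  show "X (real n) \<in> borel_measurable M" for n by (rule X.measurable_process) simp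
  fix u :: real and n :: nat
  show "X.prob {\<omega> \<in> space M. u < X (real n) \<omega>} \<le> X.prob {\<omega> \<in> space M. passage_time X Y u \<omega> \<le> ereal (real n)}"
  proof (rule X.finite_measure_mono_AE[OF _ passage_events(1)])
    \<comment> \<open>The witnesses are \<open>r = 0\<close> and \<open>s = n\<close>; the inclusion
      holds only almost surely because it uses \<open>X 0 = Y 0 = 0\<close>.\<close>
    show "AE \<omega> in M. \<omega> \<in> {\<omega> \<in> space M. u < X (real n) \<omega>} \<longrightarrow>
        \<omega> \<in> {\<omega> \<in> space M. passage_time X Y u \<omega> \<le> ereal (real n)}"
      using X.AE_start Y.AE_start
    proof eventually_elim
      case (elim \<omega>)
      then show ?case
        using passage_time_le[where X = X and Y = Y and \<omega> = \<omega> and r = 0 and s = "real n" and u = u] cadlag_paths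
        by auto
    qed
  qed
next
  fix \<epsilon> :: real assume "\<epsilon> > 0"
  \<comment> \<open>Three fluctuations share \<open>\<epsilon> * sqrt n\<close>. The deviations of
    \<open>X\<close> and \<open>Y\<close> at \<open>r\<close> may each grow with slope
    \<open>h\<close>, and \<open>2 * h\<close> is exactly the available drift
    \<open>mX - mY\<close>. The reverse deviation of \<open>X\<close> may use the whole slope
    \<open>mX\<close>.\<close>
  define e where "e = \<epsilon> / 3"
  define h where "h = (mX - mY) / 2"
  have e: "e > 0" and h: "h > 0" using \<open>\<epsilon> > 0\<close> drift by (auto simp: e_def h_def)
  define \<delta> where "\<delta> n = X.prob {\<omega> \<in> space M. reverse_dev X mX e mX n \<omega>}
    + (X.prob {\<omega> \<in> space M. forward_dev X mX e h n \<omega>} + X.prob {\<omega> \<in> space M. forward_dev Y mY e h n \<omega>})" for n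
  have "\<delta> \<longlonglongrightarrow> 0 + (0 + 0)"
    unfolding \<delta>_def
    by (intro tendsto_add X.deviation_reverse_tendsto X.deviation_forward_tendsto Y.deviation_forward_tendsto e h mX_pos)
  moreover have "X.prob {\<omega> \<in> space M. passage_time X Y u \<omega> < ereal (real n)}
      \<le> X.prob {\<omega> \<in> space M. u - \<epsilon> * sqrt n < X n \<omega>} + \<delta> n" for u n
    unfolding \<delta>_def
  proof (rule X.prob_le_three_exceptions)
    show "AE \<omega> in M. passage_time X Y u \<omega> < ereal (real n) \<longrightarrow> u - \<epsilon> * sqrt n < X n \<omega> \<or>
      reverse_dev X mX e mX n \<omega> \<or> forward_dev X mX e h n \<omega> \<or> forward_dev Y mY e h n \<omega>"
      using X.AE_start Y.AE_start AE_space
    proof eventually_elim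
      case (elim \<omega>)
      show ?case
      proof (intro impI, rule ccontr)
        assume "passage_time X Y u \<omega> < ereal (real n)"
        then obtain r s where rs: "r \<in> dyadics" "s \<in> dyadics" "r \<le> s" "s < n" "u < X s \<omega> - X r \<omega> + Y r \<omega>"
          using passage_time_less_iff[where X = X and Y = Y and \<omega> = \<omega>] cadlag_paths[OF elim(3)] by blast
        assume "\<not> (u - \<epsilon> * sqrt n < X n \<omega> \<or>
          reverse_dev X mX e mX n \<omega> \<or> forward_dev X mX e h n \<omega> \<or> forward_dev Y mY e h n \<omega>)"
        then have "X n \<omega> \<le> u - \<epsilon> * sqrt n"
          and "\<bar>X n \<omega> - X s \<omega> - mX * (n - s)\<bar> < e * sqrt n + mX * (n - s)"
          and "\<bar>X r \<omega> - X 0 \<omega> - mX * r\<bar> < e * sqrt n + h * r"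
          and "\<bar>Y r \<omega> - Y 0 \<omega> - mY * r\<bar> < e * sqrt n + h * r"
          using rs by (auto simp: not_le not_less)
        moreover have "h * r + h * r = mX * r - mY * r" by (simp add: h_def field_simps)
        moreover have "\<epsilon> * sqrt n = e * sqrt n + e * sqrt n + e * sqrt n" by (simp add: e_def)
        ultimately show False using rs(5) elim(1,2) by linarith
      qed
    qed
    show "{\<omega> \<in> space M. u - \<epsilon> * sqrt n < X n \<omega>} \<in> X.events"
      using X.measurable_process[of "real n"] by measurable
    show "{\<omega> \<in> space M. reverse_dev X mX e mX n \<omega>} \<in> X.events"
      using X.deviation_reverse_event[of 0 "real n" "real n"] by simp
  qed (rule X.deviation_forward_event Y.deviation_forward_event)+
  ultimately show "\<exists>\<delta>. \<delta> \<longlonglongrightarrow> 0 \<and> (\<forall>u n. X.prob {\<omega> \<in> space M. passage_time X Y u \<omega> < ereal (real n)}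
      \<le> X.prob {\<omega> \<in> space M. u - \<epsilon> * sqrt n < X n \<omega>} + \<delta> n)"
    by auto
qed (rule passage_events)+

text \<open>
  Here \<open>X s - X r + Y r = Y n - (X n - X s) + ((X n - X r) - (Y n - Y r))\<close>, and now the bracket has
  negative drift in \<open>n - r\<close>.
\<close>

lemma passage_limit_negative_drift:
  assumes drift: "mX < mY" and v: "vY > 0"
  shows "((\<lambda>u. X.prob {\<omega> \<in> space M. passage_time X Y u \<omega> \<le> ereal (u / mY + x * sqrt (u * vY / mY ^ 3))})
    \<longlongrightarrow> std_normal_cdf x) at_top"
proof (rule X.passage_pointwise_limit[OF _ v _ Y.central_limit_integer_times[OF v]])
  show "mY > 0" using mX_pos drift by simp
  show "Y (real n) \<in> borel_measurable M" for n by (rule Y.measurable_process) simp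
  fix u :: real and n :: nat
  \<comment> \<open>With \<open>r = s = n\<close> the terms in \<open>X\<close> cancel at every
    sample point, so no null set has to be excluded.\<close>
  show "X.prob {\<omega> \<in> space M. u < Y (real n) \<omega>} \<le> X.prob {\<omega> \<in> space M. passage_time X Y u \<omega> \<le> ereal (real n)}"
    using passage_time_le[where X = X and Y = Y and r = "real n" and s = "real n" and u = u] cadlag_paths
    by (intro X.finite_measure_mono passage_events) auto
next
  fix \<epsilon> :: real assume "\<epsilon> > 0"
  \<comment> \<open>The same budget as for positive drift, except that the slopes \<open>h\<close>
    act on \<open>n - r\<close>, where the drift \<open>mY - mX\<close> is available; hence all
    three deviations are reverse ones.\<close>
  define e where "e = \<epsilon> / 3"
  define h where "h = (mY - mX) / 2"
  have e: "e > 0" and h: "h > 0" using \<open>\<epsilon> > 0\<close> drift by (auto simp: e_def h_def)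
  define \<delta> where "\<delta> n = X.prob {\<omega> \<in> space M. reverse_dev X mX e mX n \<omega>}
    + (X.prob {\<omega> \<in> space M. reverse_dev X mX e h n \<omega>} + X.prob {\<omega> \<in> space M. reverse_dev Y mY e h n \<omega>})" for n
  have "\<delta> \<longlonglongrightarrow> 0 + (0 + 0)"
    unfolding \<delta>_def
    by (intro tendsto_add X.deviation_reverse_tendsto Y.deviation_reverse_tendsto e h mX_pos)
  moreover have "X.prob {\<omega> \<in> space M. passage_time X Y u \<omega> < ereal (real n)}
      \<le> X.prob {\<omega> \<in> space M. u - \<epsilon> * sqrt n < Y n \<omega>} + \<delta> n" for u n
    unfolding \<delta>_def
  proof (rule X.prob_le_three_exceptions)
    show "AE \<omega> in M. passage_time X Y u \<omega> < ereal (real n) \<longrightarrow> u - \<epsilon> * sqrt n < Y n \<omega> \<or>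
      reverse_dev X mX e mX n \<omega> \<or> reverse_dev X mX e h n \<omega> \<or> reverse_dev Y mY e h n \<omega>"
    proof (intro AE_I2 impI, rule ccontr)
      fix \<omega> assume "\<omega> \<in> space M" "passage_time X Y u \<omega> < ereal (real n)"
      then obtain r s where rs: "r \<in> dyadics" "s \<in> dyadics" "r \<le> s" "s < n" "u < X s \<omega> - X r \<omega> + Y r \<omega>"
        using passage_time_less_iff[where X = X and Y = Y and \<omega> = \<omega>] cadlag_paths[of \<omega>] by blast
      assume "\<not> (u - \<epsilon> * sqrt n < Y n \<omega> \<or>
        reverse_dev X mX e mX n \<omega> \<or> reverse_dev X mX e h n \<omega> \<or> reverse_dev Y mY e h n \<omega>)"
      then have "Y n \<omega> \<le> u - \<epsilon> * sqrt n"
        and "\<bar>X n \<omega> - X s \<omega> - mX * (n - s)\<bar> < e * sqrt n + mX * (n - s)"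
        and "\<bar>X n \<omega> - X r \<omega> - mX * (n - r)\<bar> < e * sqrt n + h * (n - r)"
        and "\<bar>Y n \<omega> - Y r \<omega> - mY * (n - r)\<bar> < e * sqrt n + h * (n - r)"
        using rs by (auto simp: not_le not_less)
      moreover have "h * (n - r) + h * (n - r) = mY * (n - r) - mX * (n - r)"
        by (simp add: h_def flip: add_divide_distrib left_diff_distrib)
      moreover have "\<epsilon> * sqrt n = e * sqrt n + e * sqrt n + e * sqrt n" by (simp add: e_def)
      ultimately show False using rs(5) by linarith
    qed
    show "{\<omega> \<in> space M. u - \<epsilon> * sqrt n < Y n \<omega>} \<in> X.events"
      using Y.measurable_process[of "real n"] by measurable
    show "{\<omega> \<in> space M. reverse_dev X mX e \<eta> n \<omega>} \<in> X.events" for \<eta>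
      using X.deviation_reverse_event[of 0 "real n" "real n"] by simp
    then show "{\<omega> \<in> space M. reverse_dev X mX e h n \<omega>} \<in> X.events" .
    show "{\<omega> \<in> space M. reverse_dev Y mY e h n \<omega>} \<in> X.events"
      using Y.deviation_reverse_event[of 0 "real n" "real n"] by simp
  qed
  ultimately show "\<exists>\<delta>. \<delta> \<longlonglongrightarrow> 0 \<and> (\<forall>u n. X.prob {\<omega> \<in> space M. passage_time X Y u \<omega> < ereal (real n)}
      \<le> X.prob {\<omega> \<in> space M. u - \<epsilon> * sqrt n < Y n \<omega>} + \<delta> n)"
    by auto
qed (rule passage_events)+

end

theorem theorem3p1:
  fixes M :: "'a measure"
    and X Y :: "real \<Rightarrow> 'a \<Rightarrow> real"
    and g :: "real \<Rightarrow> real"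
    and mX mY vX vY :: real
  assumes "prob_space M"
    and "levy_process M X"
    and "levy_process M Y"
    and "indep_processes M X Y"
    and "integrable M (X 1)" and "integrable M (\<lambda>\<omega>. (X 1 \<omega>)\<^sup>2)"
    and "integrable M (Y 1)" and "integrable M (\<lambda>\<omega>. (Y 1 \<omega>)\<^sup>2)"
    and "mX = prob_space.expectation M (X 1)" and "vX = prob_space.variance M (X 1)"
    and "mY = prob_space.expectation M (Y 1)" and "vY = prob_space.variance M (Y 1)"
    and "mX > 0"
  shows "(prob_space.expectation M (Z_proc X Y 1) > 0 \<and> vX > 0 \<longrightarrow>
       (\<forall>u>0. prob_space.prob M {\<omega> \<in> space M. passage_time X Y u \<omega> \<le> ereal (g u)} =
          prob_space.prob M {\<omega> \<in> space M.
            (passage_time X Y u \<omega> - ereal (u / mX)) / ereal (sqrt (u * vX / mX ^ 3))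
              \<le> ereal ((g u - u / mX) / sqrt (u * vX / mX ^ 3))}) \<and>
       ((\<exists>K. \<forall>\<^sub>F u in at_top. K \<le> (g u - u / mX) / sqrt (u * vX / mX ^ 3)) \<longrightarrow>
          (\<lambda>u. prob_space.prob M {\<omega> \<in> space M. passage_time X Y u \<omega> \<le> ereal (g u)})
            \<sim>[at_top]
          (\<lambda>u. measure std_normal_distribution {z. z \<le> (g u - u / mX) / sqrt (u * vX / mX ^ 3)})) \<and>
       ((\<lambda>u. prob_space.prob M {\<omega> \<in> space M. passage_time X Y u \<omega> \<le> ereal (g u)}
            - measure std_normal_distribution {z. z \<le> (g u - u / mX) / sqrt (u * vX / mX ^ 3)})
          \<longlongrightarrow> 0) at_top)
    \<and> (prob_space.expectation M (Z_proc X Y 1) < 0 \<and> vY > 0 \<longrightarrow>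
       (\<forall>u>0. prob_space.prob M {\<omega> \<in> space M. passage_time X Y u \<omega> \<le> ereal (g u)} =
          prob_space.prob M {\<omega> \<in> space M.
            (passage_time X Y u \<omega> - ereal (u / mY)) / ereal (sqrt (u * vY / mY ^ 3))
              \<le> ereal ((g u - u / mY) / sqrt (u * vY / mY ^ 3))}) \<and>
       ((\<exists>K. \<forall>\<^sub>F u in at_top. K \<le> (g u - u / mY) / sqrt (u * vY / mY ^ 3)) \<longrightarrow>
          (\<lambda>u. prob_space.prob M {\<omega> \<in> space M. passage_time X Y u \<omega> \<le> ereal (g u)})
            \<sim>[at_top]
          (\<lambda>u. measure std_normal_distribution {z. z \<le> (g u - u / mY) / sqrt (u * vY / mY ^ 3)})) \<and>
       ((\<lambda>u. prob_space.prob M {\<omega> \<in> space M. passage_time X Y u \<omega> \<le> ereal (g u)}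
            - measure std_normal_distribution {z. z \<le> (g u - u / mY) / sqrt (u * vY / mY ^ 3)})
          \<longlongrightarrow> 0) at_top)"
proof -
  interpret prob_space M by fact
  interpret levy_pair M X mX vX Y mY vY
    by unfold_locales (use assms in auto)
  have Z: "expectation (Z_proc X Y 1) = mX - mY"
    using assms(5,7) unfolding assms(9,11) Z_proc_def[abs_def] by simp
  note positive = passage_uniform_conclusion[OF mX_pos _ passage_events(1) passage_limit_positive_drift, where g = g]
  note negative = passage_uniform_conclusion[OF _ _ passage_events(1) passage_limit_negative_drift, where g = g]
  show ?thesis
    unfolding Z
    by ((rule conjI; rule impI; erule conjE), (rule positive; simp), (rule negative; insert mX_pos; simp))
qed

end
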